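(* The following are equivalent: (i) All one-relator groups are coherent. (ii) Every $E$-unitary one-relator special inverse monoid $M=\operatorname{Inv}\langle A\mid r=1\rangle$ has a finitely presented group of units.
   Context: For an alphabet $A$, $\overline A=A\cup A^{-1}$ with $A^{-1}$ a disjoint copy of formal inverses. $\operatorname{Inv}\langle A\mid r=1\rangle$, with $r\in\overline A^*$, is the inverse monoid defined by the presentation (the quotient of the free inverse monoid on $A$ by the congruence generated by $(r,1)$); such a monoid is called a one-relator special inverse monoid. The group of units of a monoid is the set of its two-sided invertible elements. An inverse monoid is $E$-unitary if whenever $e$ and $es$ are idempotents then $s$ is idempotent. A one-relator group is a group defined by a presentation with one defining relation. A finitely presented group is coherent if every finitely generated subgroup of it is finitely presented. *)

theory Defs
  imports "HOL-Algebra.Generated_Groups" "HOL-Library.Infinite_Typeclass"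
begin

inductive_set gen_cong :: "('a, 'm) monoid_scheme \<Rightarrow> ('a \<times> 'a) set \<Rightarrow> ('a \<times> 'a) set"
  for M (structure) and S where
  base: "(x, y) \<in> S \<Longrightarrow> x \<in> carrier M \<Longrightarrow> y \<in> carrier M \<Longrightarrow> (x, y) \<in> gen_cong M S"
| refl: "x \<in> carrier M \<Longrightarrow> (x, x) \<in> gen_cong M S"
| sym: "(x, y) \<in> gen_cong M S \<Longrightarrow> (y, x) \<in> gen_cong M S"
| trans: "(x, y) \<in> gen_cong M S \<Longrightarrow> (y, z) \<in> gen_cong M S \<Longrightarrow> (x, z) \<in> gen_cong M S"
| mult: "(x, y) \<in> gen_cong M S \<Longrightarrow> (x', y') \<in> gen_cong M S \<Longrightarrow>
           (x \<otimes> x', y \<otimes> y') \<in> gen_cong M S"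

definition cong_class ::
  "('a, 'm) monoid_scheme \<Rightarrow> ('a \<times> 'a) set \<Rightarrow> 'a \<Rightarrow> 'a set" where
  "cong_class M S x = gen_cong M S `` {x}"

definition quot_monoid ::
  "('a, 'm) monoid_scheme \<Rightarrow> ('a \<times> 'a) set \<Rightarrow> 'a set monoid" where
  "quot_monoid M S =
     \<lparr>carrier = carrier M // gen_cong M S,
      mult = (\<lambda>X Y. \<Union>x\<in>X. \<Union>y\<in>Y. cong_class M S (x \<otimes>\<^bsub>M\<^esub> y)),
      one = cong_class M S \<one>\<^bsub>M\<^esub>\<rparr>"

text \<open>The letter \<open>(a, True)\<close> stands for \<open>a\<close> and \<open>(a, False)\<close> for its formal inverse.\<close>

type_synonym 'a word = "('a \<times> bool) list"

definition words :: "'a set \<Rightarrow> 'a word set" where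
  "words A = lists (A \<times> UNIV)"

definition winv :: "'a word \<Rightarrow> 'a word" where
  "winv u = rev (map (\<lambda>(a, b). (a, \<not> b)) u)"

definition word_monoid :: "'a set \<Rightarrow> 'a word monoid" where
  "word_monoid A = \<lparr>carrier = words A, mult = (@), one = []\<rparr>"

text \<open>Wagner's presentation of the free inverse monoid.\<close>

definition wagner :: "'a set \<Rightarrow> ('a word \<times> 'a word) set" where
  "wagner A =
     {(u @ winv u @ u, u) |u. u \<in> words A} \<union>
     {(u @ winv u @ v @ winv v, v @ winv v @ u @ winv u) |u v. u \<in> words A \<and> v \<in> words A}"

definition free_inverse_monoid :: "'a set \<Rightarrow> 'a word set monoid" where
  "free_inverse_monoid A = quot_monoid (word_monoid A) (wagner A)"

text \<open>\<open>special_inv A R\<close> is \<open>Inv\<langle>A | r = 1 (r \<in> R)\<rangle>\<close>.\<close>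

definition special_inv :: "'a set \<Rightarrow> 'a word set \<Rightarrow> 'a word set set monoid" where
  "special_inv A R =
     quot_monoid (free_inverse_monoid A)
       {(cong_class (word_monoid A) (wagner A) r, \<one>\<^bsub>free_inverse_monoid A\<^esub>) |r. r \<in> R}"

definition free_reduction :: "'a set \<Rightarrow> ('a word \<times> 'a word) set" where
  "free_reduction A = {(u @ winv u, []) |u. u \<in> words A}"

definition free_grp :: "'a set \<Rightarrow> 'a word set monoid" where
  "free_grp A = quot_monoid (word_monoid A) (free_reduction A)"

text \<open>\<open>group_pres A R\<close> is the group \<open>Gp\<langle>A | r = 1 (r \<in> R)\<rangle>\<close>. The quotient of the free group
  by the congruence generated by the pairs \<open>(r, 1)\<close> is its quotient by the normal closure
  of \<open>R\<close>.\<close>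

definition group_pres :: "'a set \<Rightarrow> 'a word set \<Rightarrow> 'a word set set monoid" where
  "group_pres A R =
     quot_monoid (free_grp A)
       {(cong_class (word_monoid A) (free_reduction A) r, \<one>\<^bsub>free_grp A\<^esub>) |r. r \<in> R}"

text \<open>Natural numbers serve as letters, since every finite alphabet is in bijection with a
  finite set of natural numbers.\<close>

definition finitely_presented :: "('a, 'm) monoid_scheme \<Rightarrow> bool" where
  "finitely_presented G \<longleftrightarrow> group G \<and>
     (\<exists>(A :: nat set) R. finite A \<and> finite R \<and> R \<subseteq> words A \<and> G \<cong> group_pres A R)"

definition finitely_generated :: "('a, 'm) monoid_scheme \<Rightarrow> bool" where
  "finitely_generated G \<longleftrightarrow> group G \<and>
     (\<exists>S \<subseteq> carrier G. finite S \<and> generate G S = carrier G)"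

text \<open>Coherence is a notion for finitely presented groups \<open>G\<close>; finite presentability of \<open>G\<close>
  itself is to be assumed wherever the predicate is used.\<close>

definition coherent :: "('a, 'm) monoid_scheme \<Rightarrow> bool" where
  "coherent G \<longleftrightarrow>
     (\<forall>H. subgroup H G \<longrightarrow> finitely_generated (G\<lparr>carrier := H\<rparr>) \<longrightarrow>
          finitely_presented (G\<lparr>carrier := H\<rparr>))"

definition idempotent_elt :: "('a, 'm) monoid_scheme \<Rightarrow> 'a \<Rightarrow> bool" where
  "idempotent_elt M e \<longleftrightarrow> e \<in> carrier M \<and> e \<otimes>\<^bsub>M\<^esub> e = e"

definition E_unitary :: "('a, 'm) monoid_scheme \<Rightarrow> bool" where
  "E_unitary M \<longleftrightarrow>
     (\<forall>e s. s \<in> carrier M \<longrightarrow>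
        idempotent_elt M e \<longrightarrow> idempotent_elt M (e \<otimes>\<^bsub>M\<^esub> s) \<longrightarrow> idempotent_elt M s)"

end

theory Submission
  imports Defs
begin

text \<open>
  Both implications compare an inverse monoid \<open>M = Inv\<langle>A | r = 1\<rangle>\<close> with the group \<open>G\<close> that has the
  same presentation, which is the maximal group image of \<open>M\<close>.

  Coherence gives finitely presented units. Let \<open>N\<close> be the submonoid of \<open>G\<close> generated by the
  prefixes of \<open>r\<close>. Words act on \<open>N\<close> by right multiplication as partial injections, defined as long
  as the product stays in \<open>N\<close>, and \<open>r\<close> acts as the identity. So \<open>M\<close> acts on \<open>N\<close>, and right
  invertible elements of \<open>M\<close> map into \<open>N\<close>. If \<open>M\<close> is \<open>E\<close>-unitary, then a right invertible element with
  trivial image in \<open>G\<close> is \<open>1\<close>, and it follows that the units of \<open>M\<close> are isomorphic to the group \<open>V\<close>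
  of units of \<open>N\<close> (\<open>units_iso\<close>). A factor of a unit of \<open>N\<close> is a unit of \<open>N\<close>, as \<open>N\<close> lies in a
  group, so \<open>V\<close> is generated by the finitely many prefixes of \<open>r\<close> that it contains
  (\<open>V_generated\<close>). Coherence of \<open>G\<close> makes \<open>V\<close> finitely presented.

  Finitely presented units give coherence. Let \<open>H\<close> be the subgroup of \<open>G = Gp\<langle>X | r = 1\<rangle>\<close>
  generated by the words \<open>w\<^sub>1, \<dots>, w\<^sub>k\<close>. With a new letter \<open>t\<close>, the single relator \<open>pad pieces r\<close>
  says that \<open>r = 1\<close> and that all letters of \<open>X\<close> and all words \<open>t w\<^sub>i t\<inverse>\<close> are invertible. The
  inverse monoid \<open>M\<close> that it defines has the free product of \<open>G\<close> and \<open>\<langle>t\<rangle>\<close> as its maximal group image.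
  Reducing a word to its normal form in the free product only moves up in the natural order of \<open>M\<close>,
  so elements of \<open>M\<close> with trivial image lie below \<open>1\<close>, and \<open>M\<close> is \<open>E\<close>-unitary (\<open>E_unitary_M\<close>). The
  map \<open>h \<mapsto> t h t\<inverse>\<close> embeds \<open>H\<close> in the units of \<open>M\<close> (\<open>\<sigma>_hom\<close>). The units have exponent sum zero in
  \<open>t\<close>, and in an extension of \<open>G \<times> G\<close> in which \<open>t\<close> swaps the two factors they have a second
  coordinate in \<open>H\<close>, which gives a left inverse of this embedding (\<open>\<rho>_hom\<close>). So \<open>H\<close> is a retract
  of a finitely presented group, and a retract of a finitely presented group is finitely presented
  (\<open>finitely_presented_retract\<close>).
\<close>

section \<open>Quotients of monoids by generated congruences\<close>

context monoid
begin

lemma gen_cong_carrier: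
  "(x, y) \<in> gen_cong G S \<Longrightarrow> x \<in> carrier G \<and> y \<in> carrier G"
  by (induction rule: gen_cong.induct) auto

lemma equiv_gen_cong: "equiv (carrier G) (gen_cong G S)"
  by (rule equivI)
    (auto simp: refl_on_def sym_on_def trans_on_def dest: gen_cong_carrier
      intro: gen_cong.refl gen_cong.sym gen_cong.trans)

lemma cong_class_eq_iff:
  "x \<in> carrier G \<Longrightarrow> y \<in> carrier G \<Longrightarrow>
    cong_class G S x = cong_class G S y \<longleftrightarrow> (x, y) \<in> gen_cong G S"
  unfolding cong_class_def by (rule eq_equiv_class_iff[OF equiv_gen_cong])

lemma carrier_quot_monoid: "carrier (quot_monoid G S) = cong_class G S ` carrier G"
  by (auto simp: quot_monoid_def quotient_def cong_class_def)

lemma one_quot_monoid: "\<one>\<^bsub>quot_monoid G S\<^esub> = cong_class G S \<one>"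
  by (simp add: quot_monoid_def)

lemma mult_quot_monoid:
  assumes "x \<in> carrier G" "y \<in> carrier G"
  shows "cong_class G S x \<otimes>\<^bsub>quot_monoid G S\<^esub> cong_class G S y = cong_class G S (x \<otimes> y)"
proof -
  have "cong_class G S (x' \<otimes> y') = cong_class G S (x \<otimes> y)"
    if "(x, x') \<in> gen_cong G S" "(y, y') \<in> gen_cong G S" for x' y'
    using that gen_cong_carrier[OF that(1)] gen_cong_carrier[OF that(2)]
    by (simp add: cong_class_eq_iff gen_cong.mult gen_cong.sym)
  then have "(\<Union>x'\<in>cong_class G S x. \<Union>y'\<in>cong_class G S y. cong_class G S (x' \<otimes> y'))
      = (\<Union>x'\<in>cong_class G S x. \<Union>y'\<in>cong_class G S y. cong_class G S (x \<otimes> y))"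
    by (intro SUP_cong refl) (simp_all add: cong_class_def)
  moreover have "x \<in> cong_class G S x" "y \<in> cong_class G S y"
    using assms by (auto simp: cong_class_def gen_cong.refl)
  ultimately show ?thesis
    by (auto simp: quot_monoid_def)
qed

lemma monoid_quot_monoid: "monoid (quot_monoid G S)"
  by (rule monoidI)
    (auto simp: carrier_quot_monoid one_quot_monoid mult_quot_monoid m_assoc)

end

section \<open>Words and presented monoids\<close>

lemma words_simps [simp]:
  "[] \<in> words A" "u @ v \<in> words A \<longleftrightarrow> u \<in> words A \<and> v \<in> words A"
  "l # u \<in> words A \<longleftrightarrow> fst l \<in> A \<and> u \<in> words A"
  by (cases l; auto simp: words_def)+

lemma words_iff: "u \<in> words A \<longleftrightarrow> fst ` set u \<subseteq> A"
  by (auto simp: words_def lists_eq_set subset_iff)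

lemma winv_simps [simp]:
  "winv [] = []" "winv ((a, b) # u) = winv u @ [(a, \<not> b)]" "winv (u @ v) = winv v @ winv u"
  "winv (winv u) = u"
  by (auto simp: winv_def rev_map comp_def split_def)

lemma winv_in_words [simp]: "winv u \<in> words A \<longleftrightarrow> u \<in> words A"
  by (force simp: words_iff winv_def)

lemma word_monoid_simps [simp]:
  "carrier (word_monoid A) = words A" "u \<otimes>\<^bsub>word_monoid A\<^esub> v = u @ v" "\<one>\<^bsub>word_monoid A\<^esub> = []"
  by (simp_all add: word_monoid_def)

lemma monoid_word_monoid: "monoid (word_monoid A)"
  by (rule monoidI) auto

text \<open>Free inverse monoids and free groups are quotients of word monoids, and a presentation
  takes a second quotient. Both kinds of presented object are instances of this double quotient,
  whose classes are described below by one congruence on words.\<close>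

definition pres :: "'a set \<Rightarrow> ('a word \<times> 'a word) set \<Rightarrow> 'a word set \<Rightarrow> 'a word set set monoid" where
  "pres A S R = quot_monoid (quot_monoid (word_monoid A) S)
     {(cong_class (word_monoid A) S r, \<one>\<^bsub>quot_monoid (word_monoid A) S\<^esub>) |r. r \<in> R}"

definition pcl :: "'a set \<Rightarrow> ('a word \<times> 'a word) set \<Rightarrow> 'a word set \<Rightarrow> 'a word \<Rightarrow> 'a word set set" where
  "pcl A S R u = cong_class (quot_monoid (word_monoid A) S)
     {(cong_class (word_monoid A) S r, \<one>\<^bsub>quot_monoid (word_monoid A) S\<^esub>) |r. r \<in> R}
     (cong_class (word_monoid A) S u)"

lemma special_inv_eq_pres: "special_inv A R = pres A (wagner A) R"
  by (simp add: special_inv_def free_inverse_monoid_def pres_def)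

lemma group_pres_eq_pres: "group_pres A R = pres A (free_reduction A) R"
  by (simp add: group_pres_def free_grp_def pres_def)

abbreviation "gcl A R \<equiv> pcl A (free_reduction A) R"
abbreviation "icl A R \<equiv> pcl A (wagner A) R"

abbreviation rels :: "('a word \<times> 'a word) set \<Rightarrow> 'a word set \<Rightarrow> ('a word \<times> 'a word) set" where
  "rels S R \<equiv> S \<union> (\<lambda>r. (r, [])) ` R"

context
  fixes A :: "'a set" and S :: "('a word \<times> 'a word) set" and R :: "'a word set"
begin

interpretation W: monoid "word_monoid A" by (rule monoid_word_monoid)
interpretation Q: monoid "quot_monoid (word_monoid A) S" by (rule W.monoid_quot_monoid)

lemma carrier_pres: "carrier (pres A S R) = pcl A S R ` words A"
  by (auto simp: pres_def pcl_def Q.carrier_quot_monoid W.carrier_quot_monoid)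

lemma one_pres: "\<one>\<^bsub>pres A S R\<^esub> = pcl A S R []"
  by (simp add: pres_def pcl_def Q.one_quot_monoid W.one_quot_monoid)

lemma pcl_append:
  "u \<in> words A \<Longrightarrow> v \<in> words A \<Longrightarrow> pcl A S R (u @ v) = pcl A S R u \<otimes>\<^bsub>pres A S R\<^esub> pcl A S R v"
  by (simp add: pres_def pcl_def Q.mult_quot_monoid W.mult_quot_monoid W.carrier_quot_monoid)

lemma monoid_pres: "monoid (pres A S R)"
  unfolding pres_def by (rule Q.monoid_quot_monoid)

lemma pcl_eq_iff:
  assumes R: "R \<subseteq> words A" and uv: "u \<in> words A" "v \<in> words A"
  shows "pcl A S R u = pcl A S R v \<longleftrightarrow> (u, v) \<in> gen_cong (word_monoid A) (rels S R)"
proof -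
  let ?c = "cong_class (word_monoid A) S"
  let ?T = "{(?c r, \<one>\<^bsub>quot_monoid (word_monoid A) S\<^esub>) |r. r \<in> R}"
  let ?C = "gen_cong (word_monoid A) (rels S R)"
  have sub: "(x, y) \<in> ?C" if "(x, y) \<in> gen_cong (word_monoid A) S" for x y
    using that
  proof induction
    case (base x y) then show ?case by (simp add: gen_cong.base)
  next
    case (refl x) then show ?case by (simp add: gen_cong.refl)
  next
    case (sym x y) show ?case by (rule gen_cong.sym) fact
  next
    case (trans x y z) then show ?case by (blast intro: gen_cong.trans)
  next
    case (mult x y x' y') then show ?case by (blast intro: gen_cong.mult)
  qed
  have down: "(x, y) \<in> ?C" if "x \<in> words A" "y \<in> words A" "?c x = ?c y" for x y
    using that by (auto simp: W.cong_class_eq_iff intro: sub)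
  have l: "\<forall>x\<in>words A. \<forall>y\<in>words A. X = ?c x \<longrightarrow> Y = ?c y \<longrightarrow> (x, y) \<in> ?C"
    if "(X, Y) \<in> gen_cong (quot_monoid (word_monoid A) S) ?T" for X Y
    using that
  proof induction
    case (base X Y)
    then obtain r where r: "r \<in> R" "X = ?c r" "Y = ?c []"
      by (auto simp: W.one_quot_monoid)
    show ?case
    proof (intro ballI impI)
      fix x y assume xy: "x \<in> words A" "y \<in> words A" "X = ?c x" "Y = ?c y"
      have "(x, r) \<in> ?C" "([], y) \<in> ?C" using r xy R by (auto intro!: down)
      moreover have "(r, []) \<in> ?C" using r R by (intro gen_cong.base) auto
      ultimately show "(x, y) \<in> ?C" by (blast intro: gen_cong.trans)
    qed
  next
    case (refl X) then show ?case by (auto intro: down)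
  next
    case (sym X Y) then show ?case by (blast intro: gen_cong.sym)
  next
    case (trans X Y Z)
    then have "Y \<in> carrier (quot_monoid (word_monoid A) S)" using Q.gen_cong_carrier by blast
    then obtain y where "y \<in> words A" "Y = ?c y" by (auto simp: W.carrier_quot_monoid)
    then show ?case using trans.IH by (blast intro: gen_cong.trans)
  next
    case (mult X Y X' Y')
    then have "X \<in> carrier (quot_monoid (word_monoid A) S)" "Y \<in> carrier (quot_monoid (word_monoid A) S)"
      "X' \<in> carrier (quot_monoid (word_monoid A) S)" "Y' \<in> carrier (quot_monoid (word_monoid A) S)"
      using Q.gen_cong_carrier by blast+
    then obtain x y x' y' where w: "x \<in> words A" "y \<in> words A" "x' \<in> words A" "y' \<in> words A"
      and e: "X = ?c x" "Y = ?c y" "X' = ?c x'" "Y' = ?c y'"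
      by (auto simp: W.carrier_quot_monoid)
    have m: "(x @ x', y @ y') \<in> ?C"
      using gen_cong.mult[of x y "word_monoid A" _ x' y'] mult.IH w e by auto
    show ?case
    proof (intro ballI impI)
      fix z z' assume z: "z \<in> words A" "z' \<in> words A"
        "X \<otimes>\<^bsub>quot_monoid (word_monoid A) S\<^esub> X' = ?c z" "Y \<otimes>\<^bsub>quot_monoid (word_monoid A) S\<^esub> Y' = ?c z'"
      then have "(z, x @ x') \<in> ?C" "(y @ y', z') \<in> ?C"
        using w e by (auto intro!: down simp: W.mult_quot_monoid)
      then show "(z, z') \<in> ?C" using m by (blast intro: gen_cong.trans)
    qed
  qed
  have r: "pcl A S R x = pcl A S R y" if "(x, y) \<in> ?C" for x y
    using that
  proof induction
    case (base x y)
    show ?case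
    proof (cases "(x, y) \<in> S")
      case True
      then have "?c x = ?c y" using base by (auto simp: W.cong_class_eq_iff intro: gen_cong.base)
      then show ?thesis by (simp add: pcl_def)
    next
      case False
      then have "x \<in> R" "y = []" using base by auto
      then have "(?c x, ?c y) \<in> gen_cong (quot_monoid (word_monoid A) S) ?T"
        using base by (intro gen_cong.base) (auto simp: W.one_quot_monoid W.carrier_quot_monoid)
      then show ?thesis using base
        by (simp add: pcl_def Q.cong_class_eq_iff W.carrier_quot_monoid)
    qed
  next
    case (mult x y x' y')
    then show ?case
      using W.gen_cong_carrier[OF mult.hyps(1)] W.gen_cong_carrier[OF mult.hyps(2)]
      by (auto simp: pcl_append)
  qed auto
  show ?thesis
  proof
    assume "pcl A S R u = pcl A S R v"
    then have "(?c u, ?c v) \<in> gen_cong (quot_monoid (word_monoid A) S) ?T"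
      using uv by (subst (asm) pcl_def, subst (asm) pcl_def)
        (auto simp: Q.cong_class_eq_iff W.carrier_quot_monoid)
    then show "(u, v) \<in> ?C" using l uv by blast
  qed (rule r)
qed

lemma pcl_relator: "R \<subseteq> words A \<Longrightarrow> r \<in> R \<Longrightarrow> pcl A S R r = pcl A S R []"
  by (subst pcl_eq_iff) (auto intro!: gen_cong.base)

lemma pcl_base:
  "R \<subseteq> words A \<Longrightarrow> (u, v) \<in> S \<Longrightarrow> u \<in> words A \<Longrightarrow> v \<in> words A \<Longrightarrow> pcl A S R u = pcl A S R v"
  by (subst pcl_eq_iff) (auto intro: gen_cong.base)

end

lemma gen_cong_words:
  "(u, v) \<in> gen_cong (word_monoid A) S \<Longrightarrow> u \<in> words A \<and> v \<in> words A"
  using monoid.gen_cong_carrier[OF monoid_word_monoid] by force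

section \<open>Groups given by presentations\<close>

lemma carrier_group_pres: "carrier (group_pres A R) = gcl A R ` words A"
  by (simp add: group_pres_eq_pres carrier_pres)

lemma gcl_closed: "u \<in> words A \<Longrightarrow> gcl A R u \<in> carrier (group_pres A R)"
  by (simp add: carrier_group_pres)

lemma one_group_pres: "\<one>\<^bsub>group_pres A R\<^esub> = gcl A R []"
  by (simp add: group_pres_eq_pres one_pres)

lemma gcl_append:
  "u \<in> words A \<Longrightarrow> v \<in> words A \<Longrightarrow>
    gcl A R (u @ v) = gcl A R u \<otimes>\<^bsub>group_pres A R\<^esub> gcl A R v"
  by (simp add: group_pres_eq_pres pcl_append)

lemma gcl_Cons:
  "fst l \<in> A \<Longrightarrow> u \<in> words A \<Longrightarrow>
    gcl A R (l # u) = gcl A R [l] \<otimes>\<^bsub>group_pres A R\<^esub> gcl A R u"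
  using gcl_append[of "[l]" A u R] by simp

lemma gcl_winv_right: "R \<subseteq> words A \<Longrightarrow> u \<in> words A \<Longrightarrow> gcl A R (u @ winv u) = gcl A R []"
  by (rule pcl_base) (auto simp: free_reduction_def)

lemma group_group_pres:
  assumes "R \<subseteq> words A" shows "group (group_pres A R)"
proof -
  interpret monoid "group_pres A R" using monoid_pres[of A "free_reduction A" R] by (simp add: group_pres_eq_pres)
  show ?thesis
  proof (rule group_l_invI)
    fix x assume "x \<in> carrier (group_pres A R)"
    then obtain u where u: "u \<in> words A" "x = gcl A R u" by (auto simp: carrier_group_pres)
    then have "gcl A R (winv u) \<otimes>\<^bsub>group_pres A R\<^esub> x = \<one>\<^bsub>group_pres A R\<^esub>"
      using gcl_winv_right[OF assms, of "winv u"] by (simp add: gcl_append one_group_pres)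
    then show "\<exists>y\<in>carrier (group_pres A R). y \<otimes>\<^bsub>group_pres A R\<^esub> x = \<one>\<^bsub>group_pres A R\<^esub>"
      using u gcl_closed[of "winv u" A R] by auto
  qed
qed

lemma inv_gcl:
  assumes "R \<subseteq> words A" "u \<in> words A"
  shows "inv\<^bsub>group_pres A R\<^esub> gcl A R u = gcl A R (winv u)"
proof -
  interpret group "group_pres A R" by (rule group_group_pres[OF assms(1)])
  show ?thesis
    using assms gcl_winv_right[OF assms(1), of "winv u"]
    by (intro inv_equality) (simp_all add: gcl_closed gcl_append one_group_pres)
qed

definition wev :: "('b, 'm) monoid_scheme \<Rightarrow> ('a \<Rightarrow> 'b) \<Rightarrow> 'a word \<Rightarrow> 'b" where
  "wev K f u =
    foldr (\<lambda>l y. (if snd l then f (fst l) else inv\<^bsub>K\<^esub> f (fst l)) \<otimes>\<^bsub>K\<^esub> y) u \<one>\<^bsub>K\<^esub>"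

lemma wev_simps [simp]:
  "wev K f [] = \<one>\<^bsub>K\<^esub>"
  "wev K f ((a, b) # u) = (if b then f a else inv\<^bsub>K\<^esub> f a) \<otimes>\<^bsub>K\<^esub> wev K f u"
  by (simp_all add: wev_def)

lemma wev_cong: "u \<in> words A \<Longrightarrow> (\<And>a. a \<in> A \<Longrightarrow> f a = g a) \<Longrightarrow> wev K f u = wev K g u"
  by (induction u) auto

lemma wev_map: "wev K f (map (\<lambda>(a, b). (h a, b)) u) = wev K (f \<circ> h) u"
  by (induction u) auto

context group
begin

lemma wev_closed: "f \<in> A \<rightarrow> carrier G \<Longrightarrow> u \<in> words A \<Longrightarrow> wev G f u \<in> carrier G"
  by (induction u) (auto simp: Pi_iff)

lemma wev_append:
  "f \<in> A \<rightarrow> carrier G \<Longrightarrow> u \<in> words A \<Longrightarrow> v \<in> words A \<Longrightarrow>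
    wev G f (u @ v) = wev G f u \<otimes> wev G f v"
  by (induction u) (auto simp: wev_closed m_assoc Pi_iff)

lemma wev_winv:
  "f \<in> A \<rightarrow> carrier G \<Longrightarrow> u \<in> words A \<Longrightarrow> wev G f (winv u) = inv (wev G f u)"
  by (induction u) (auto simp: wev_closed wev_append[where A = A] inv_mult_group Pi_iff)

lemma gcl_eq_imp_wev_eq:
  assumes f: "f \<in> A \<rightarrow> carrier G" and R: "R \<subseteq> words A" "\<And>r. r \<in> R \<Longrightarrow> wev G f r = \<one>"
    and uv: "u \<in> words A" "v \<in> words A" "gcl A R u = gcl A R v"
  shows "wev G f u = wev G f v"
proof -
  have "(u, v) \<in> gen_cong (word_monoid A) (rels (free_reduction A) R)"
    using R uv by (simp add: pcl_eq_iff)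
  then show ?thesis
  proof induction
    case (base x y)
    then show ?case
      by (auto simp: R free_reduction_def wev_append[OF f] wev_winv[OF f] wev_closed[OF f])
  next
    case (mult x y x' y')
    then show ?case
      using gen_cong_words[OF mult.hyps(1)] gen_cong_words[OF mult.hyps(2)]
      by (simp add: wev_append[OF f])
  qed simp_all
qed

text \<open>This is the universal property of a presented group.\<close>

lemma group_pres_lift:
  assumes f: "f \<in> A \<rightarrow> carrier G" and R: "R \<subseteq> words A" "\<And>r. r \<in> R \<Longrightarrow> wev G f r = \<one>"
  obtains h where "h \<in> hom (group_pres A R) G" "\<And>u. u \<in> words A \<Longrightarrow> h (gcl A R u) = wev G f u"
proof -
  define h where "h x = wev G f (SOME u. u \<in> words A \<and> gcl A R u = x)" for x
  have h: "h (gcl A R u) = wev G f u" if "u \<in> words A" for u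
    unfolding h_def
  proof (rule someI2[of _ u])
    fix v assume "v \<in> words A \<and> gcl A R v = gcl A R u"
    then show "wev G f v = wev G f u" using that gcl_eq_imp_wev_eq[OF f R, of v u] by simp
  qed (use that in simp)
  have "h \<in> hom (group_pres A R) G"
    by (rule homI) (auto simp: carrier_group_pres h wev_closed[OF f] wev_append[OF f] simp flip: gcl_append)
  then show ?thesis using h that by blast
qed

end

lemma wev_hom:
  assumes "group K" "group L" "h \<in> hom K L" "f \<in> A \<rightarrow> carrier K" "u \<in> words A"
  shows "h (wev K f u) = wev L (h \<circ> f) u"
proof -
  interpret group_hom K L h using assms by (simp add: group_hom_def group_hom_axioms_def)
  show ?thesis using assms(4,5)
    by (induction u) (auto simp: group.wev_closed[OF \<open>group K\<close>] Pi_iff)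
qed

lemma gcl_eq_wev:
  assumes "R \<subseteq> words A" "u \<in> words A"
  shows "gcl A R u = wev (group_pres A R) (\<lambda>a. gcl A R [(a, True)]) u"
  using assms(2)
proof (induction u)
  case Nil
  then show ?case by (simp add: one_group_pres)
next
  case (Cons l u)
  then show ?case
    using inv_gcl[OF assms(1), of "[(fst l, True)]"] by (cases l) (auto simp: gcl_Cons[of _ A u])
qed

lemma finitely_presented_iso:
  "group K \<Longrightarrow> K \<cong> L \<Longrightarrow> finitely_presented L \<Longrightarrow> finitely_presented K"
  unfolding finitely_presented_def by (blast intro: iso_trans)

text \<open>The homomorphism from the presented group given by the universal property is bijective under
  these hypotheses. Renaming the letters to natural numbers does not affect this.\<close>

lemma finitely_presentedI:
  fixes A :: "'a set"
  assumes K: "group K" and fin: "finite A" "finite R" and R: "R \<subseteq> words A"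
    and f: "f \<in> A \<rightarrow> carrier K"
    and surj: "\<And>x. x \<in> carrier K \<Longrightarrow> \<exists>u\<in>words A. x = wev K f u"
    and rel: "\<And>r. r \<in> R \<Longrightarrow> wev K f r = \<one>\<^bsub>K\<^esub>"
    and ker: "\<And>u v. u \<in> words A \<Longrightarrow> v \<in> words A \<Longrightarrow> wev K f u = wev K f v \<Longrightarrow> gcl A R u = gcl A R v"
  shows "finitely_presented K"
proof -
  interpret K: group K by (rule K)
  obtain \<nu> :: "'a \<Rightarrow> nat" where \<nu>: "inj_on \<nu> A" using finite_imp_inj_to_nat_seg[OF fin(1)] by blast
  let ?m = "map (\<lambda>(a, b). (\<nu> a, b))"
  let ?A = "\<nu> ` A" and ?R = "?m ` R"
  let ?f = "f \<circ> inv_into A \<nu>"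
  have mw: "?m u \<in> words ?A" if "u \<in> words A" for u using that by (force simp: words_iff)
  have R': "?R \<subseteq> words ?A" using R mw by blast
  have wm: "wev K ?f (?m u) = wev K f u" if "u \<in> words A" for u
    unfolding wev_map by (rule wev_cong[OF that]) (simp add: \<nu>)
  have f': "?f \<in> ?A \<rightarrow> carrier K" using f \<nu> by auto
  have rel': "wev K ?f r = \<one>\<^bsub>K\<^esub>" if "r \<in> ?R" for r
    using that rel wm R by auto
  obtain h where h: "h \<in> hom (group_pres ?A ?R) K"
    and hg: "\<And>u. u \<in> words ?A \<Longrightarrow> h (gcl ?A ?R u) = wev K ?f u"
    using K.group_pres_lift[OF f' R' rel'] by blast
  have pre: "\<exists>u\<in>words A. v = ?m u" if "v \<in> words ?A" for v
    using that
  proof (induction v)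
    case (Cons l v)
    then obtain u a where "u \<in> words A" "v = ?m u" "a \<in> A" "fst l = \<nu> a" by auto
    then show ?case by (intro bexI[of _ "(a, snd l) # u"]) (auto simp: prod_eq_iff)
  qed auto
  interpret P: group "group_pres ?A ?R" by (rule group_group_pres[OF R'])
  have up: "gcl ?A ?R (?m u) = gcl ?A ?R (?m v)"
    if "u \<in> words A" "v \<in> words A" "gcl A R u = gcl A R v" for u v
  proof -
    let ?g = "(\<lambda>a. gcl ?A ?R [(a, True)]) \<circ> \<nu>"
    have g: "?g \<in> A \<rightarrow> carrier (group_pres ?A ?R)" by (auto intro!: gcl_closed)
    have w: "wev (group_pres ?A ?R) ?g u = gcl ?A ?R (?m u)" if "u \<in> words A" for u
      using gcl_eq_wev[OF R' mw[OF that]] by (simp add: wev_map)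
    have "wev (group_pres ?A ?R) ?g r = \<one>\<^bsub>group_pres ?A ?R\<^esub>" if "r \<in> R" for r
      using w[of r] that R pcl_relator[OF R', of "?m r" "free_reduction ?A"] by (auto simp: one_group_pres)
    then show ?thesis using P.gcl_eq_imp_wev_eq[OF g R _ that] w that by simp
  qed
  have rep: "\<exists>u\<in>words A. x = gcl ?A ?R (?m u)" if x: "x \<in> carrier (group_pres ?A ?R)" for x
  proof -
    obtain v where v: "v \<in> words ?A" "x = gcl ?A ?R v"
      using x unfolding carrier_group_pres by (elim imageE)
    obtain u where "u \<in> words A" "v = ?m u" using pre[OF v(1)] by (elim bexE)
    then show ?thesis using v(2) by (intro bexI[of _ u]) simp_all
  qed
  have "inj_on h (carrier (group_pres ?A ?R))"
  proof (rule inj_onI)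
    fix x y assume xy: "x \<in> carrier (group_pres ?A ?R)" "y \<in> carrier (group_pres ?A ?R)" and e: "h x = h y"
    obtain u where u: "u \<in> words A" "x = gcl ?A ?R (?m u)" using rep[OF xy(1)] by blast
    obtain v where v: "v \<in> words A" "y = gcl ?A ?R (?m v)" using rep[OF xy(2)] by blast
    have "h x = wev K f u" "h y = wev K f v" using u v by (simp_all add: hg mw wm)
    then have "gcl A R u = gcl A R v" using e by (intro ker[OF u(1) v(1)]) simp
    then show "x = y" using up[OF u(1) v(1)] u(2) v(2) by simp
  qed
  moreover have "carrier K \<subseteq> h ` carrier (group_pres ?A ?R)"
  proof
    fix x assume "x \<in> carrier K"
    then obtain u where u: "u \<in> words A" "x = wev K f u" using surj by blast
    then have "x = h (gcl ?A ?R (?m u))" by (simp add: hg mw wm)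
    then show "x \<in> h ` carrier (group_pres ?A ?R)" using u gcl_closed mw by blast
  qed
  moreover have "h ` carrier (group_pres ?A ?R) \<subseteq> carrier K"
    using h by (auto simp: hom_def)
  ultimately have "h \<in> iso (group_pres ?A ?R) K" using h by (auto simp: iso_def bij_betw_def)
  then have "K \<cong> group_pres ?A ?R" using P.iso_sym by (auto simp: is_iso_def)
  then show ?thesis unfolding finitely_presented_def using K fin R' by (meson finite_imageI)
qed

lemma finitely_presented_group_pres:
  assumes "finite A" "finite R" "R \<subseteq> words A"
  shows "finitely_presented (group_pres A R)"
proof (rule finitely_presentedI[OF group_group_pres[OF assms(3)] assms])
  fix r assume "r \<in> R"
  then show "wev (group_pres A R) (\<lambda>a. gcl A R [(a, True)]) r = \<one>\<^bsub>group_pres A R\<^esub>"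
    using assms(3) pcl_relator[OF assms(3), of r "free_reduction A"]
    by (subst gcl_eq_wev[symmetric]) (auto simp: one_group_pres)
qed (auto simp: carrier_group_pres gcl_eq_wev[OF assms(3), symmetric])

text \<open>If \<open>A\<close> and \<open>R\<close> present \<open>U\<close> and \<open>\<rho>\<close> is a retraction of \<open>U\<close>, then adding to \<open>R\<close> the
  equations between each letter \<open>a\<close> and a word for its retract presents the image of \<open>\<rho>\<close>:
  modulo the new relators every word equals a word for its retract.\<close>

lemma finitely_presented_retract:
  assumes U: "finitely_presented U" and H: "group H"
    and \<sigma>: "\<sigma> \<in> hom H U" and \<rho>: "\<rho> \<in> hom U H" and \<rho>\<sigma>: "\<And>x. x \<in> carrier H \<Longrightarrow> \<rho> (\<sigma> x) = x"
  shows "finitely_presented H"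
proof -
  interpret H: group H by (rule H)
  interpret U: group U using U by (simp add: finitely_presented_def)
  obtain A :: "nat set" and R where fin: "finite A" "finite R" and R: "R \<subseteq> words A" and "U \<cong> group_pres A R"
    using U by (auto simp: finitely_presented_def)
  then obtain \<psi> where \<psi>: "\<psi> \<in> iso U (group_pres A R)" by (auto simp: is_iso_def)
  define \<chi> where "\<chi> = inv_into (carrier U) \<psi>"
  have \<chi>: "\<chi> \<in> hom (group_pres A R) U" using U.iso_set_sym[OF \<psi>] by (simp add: \<chi>_def iso_def)
  have \<chi>\<psi>: "\<chi> (\<psi> x) = x" if "x \<in> carrier U" for x
    using \<psi> that by (auto simp: iso_def \<chi>_def bij_betw_def)
  have \<psi>h: "\<psi> \<in> hom U (group_pres A R)" using \<psi> by (simp add: iso_def)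
  interpret P: group "group_pres A R" by (rule group_group_pres[OF R])
  define f where "f a = \<rho> (\<chi> (gcl A R [(a, True)]))" for a
  have \<rho>\<chi>: "\<rho> \<circ> \<chi> \<in> hom (group_pres A R) H" by (rule hom_compose[OF \<chi> \<rho>])
  have f: "f \<in> A \<rightarrow> carrier H"
    using \<rho>\<chi> by (auto simp: f_def hom_def Pi_iff gcl_closed)
  have fw: "wev H f u = \<rho> (\<chi> (gcl A R u))" if "u \<in> words A" for u
    using wev_hom[OF P.is_group H \<rho>\<chi> _ that, of "\<lambda>a. gcl A R [(a, True)]"] gcl_eq_wev[OF R that]
    by (simp add: gcl_closed Pi_iff f_def[abs_def] comp_def)
  have "\<exists>w\<in>words A. gcl A R w = \<psi> (\<sigma> (f a))" if "a \<in> A" for a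
  proof -
    have "\<psi> (\<sigma> (f a)) \<in> carrier (group_pres A R)"
      using f that \<sigma> \<psi>h by (auto simp: hom_def Pi_iff)
    then show ?thesis by (auto simp: carrier_group_pres)
  qed
  then obtain w where w: "\<And>a. a \<in> A \<Longrightarrow> w a \<in> words A" "\<And>a. a \<in> A \<Longrightarrow> gcl A R (w a) = \<psi> (\<sigma> (f a))"
    by metis
  define R' where "R' = R \<union> (\<lambda>a. (a, False) # w a) ` A"
  have R': "R' \<subseteq> words A" using R w by (auto simp: R'_def)
  interpret P': group "group_pres A R'" by (rule group_group_pres[OF R'])
  have rel: "gcl A R' r = \<one>\<^bsub>group_pres A R'\<^esub>" if "r \<in> R'" for r
    using pcl_relator[OF R' that] by (simp add: one_group_pres)
  have g: "(\<lambda>a. gcl A R' [(a, True)]) \<in> A \<rightarrow> carrier (group_pres A R')" by (auto intro!: gcl_closed)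
  have gr: "wev (group_pres A R') (\<lambda>a. gcl A R' [(a, True)]) r = \<one>\<^bsub>group_pres A R'\<^esub>" if "r \<in> R" for r
    using gcl_eq_wev[OF R', of r] rel[of r] that R by (auto simp: R'_def)
  obtain d where d: "d \<in> hom (group_pres A R) (group_pres A R')"
    and "\<And>u. u \<in> words A \<Longrightarrow> d (gcl A R u) = wev (group_pres A R') (\<lambda>a. gcl A R' [(a, True)]) u"
    using P'.group_pres_lift[OF g R gr] by blast
  then have dg: "d (gcl A R u) = gcl A R' u" if "u \<in> words A" for u
    using that gcl_eq_wev[OF R'] by simp
  define \<eta> where "\<eta> = d \<circ> \<psi> \<circ> \<sigma>"
  have \<eta>: "\<eta> \<in> hom H (group_pres A R')"
    unfolding \<eta>_def by (intro hom_compose[OF \<sigma>] hom_compose[OF \<psi>h] d)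
  have \<eta>f: "\<eta> (f a) = gcl A R' [(a, True)]" if a: "a \<in> A" for a
  proof -
    have "inv\<^bsub>group_pres A R'\<^esub> gcl A R' [(a, True)] \<otimes>\<^bsub>group_pres A R'\<^esub> gcl A R' (w a) = \<one>\<^bsub>group_pres A R'\<^esub>"
      using a w rel[of "(a, False) # w a"] inv_gcl[OF R', of "[(a, True)]"]
      by (simp add: R'_def gcl_Cons[of _ A "w a"])
    then have "gcl A R' (w a) = gcl A R' [(a, True)]"
      using a w gcl_closed[of "w a" A R'] gcl_closed[of "[(a, True)]" A R']
      by (metis P'.inv_closed P'.inv_equality P'.inv_inv P'.inv_comm fst_conv words_simps(1,3))
    then show ?thesis using w[OF a] dg[OF w(1)[OF a]] by (simp add: \<eta>_def)
  qed
  have \<eta>w: "\<eta> (wev H f u) = gcl A R' u" if "u \<in> words A" for u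
    using wev_hom[OF H P'.is_group \<eta> f that] wev_cong[OF that, of "\<eta> \<circ> f" "\<lambda>a. gcl A R' [(a, True)]"] \<eta>f
      gcl_eq_wev[OF R' that] by simp
  show ?thesis
  proof (rule finitely_presentedI[OF H _ _ R' f])
    show "finite A" "finite R'" using fin by (auto simp: R'_def)
  next
    fix x assume x: "x \<in> carrier H"
    then have "\<psi> (\<sigma> x) \<in> carrier (group_pres A R)" using \<sigma> \<psi>h by (auto simp: hom_def)
    then obtain u where u: "u \<in> words A" "\<psi> (\<sigma> x) = gcl A R u" by (auto simp: carrier_group_pres)
    moreover have "\<sigma> x \<in> carrier U" using x \<sigma> by (auto simp: hom_def)
    ultimately have "x = wev H f u" using fw[OF u(1)] \<chi>\<psi> \<rho>\<sigma>[OF x] by force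
    then show "\<exists>u\<in>words A. x = wev H f u" using u by blast
  next
    fix r assume r: "r \<in> R'"
    have one: "wev H f r = \<one>\<^bsub>H\<^esub>" if "r \<in> R" for r
    proof -
      have "gcl A R r = \<one>\<^bsub>group_pres A R\<^esub>" using pcl_relator[OF R that] by (simp add: one_group_pres)
      then show ?thesis
        using fw[of r] R that hom_one[OF \<rho>\<chi> P.is_group H] by auto
    qed
    show "wev H f r = \<one>\<^bsub>H\<^esub>"
    proof (cases "r \<in> R")
      case False
      then obtain a where a: "a \<in> A" "r = (a, False) # w a" using r by (auto simp: R'_def)
      have fa: "f a \<in> carrier H" using f a by auto
      then have "\<sigma> (f a) \<in> carrier U" using \<sigma> by (auto simp: hom_def)
      then have "wev H f (w a) = f a" using fw w a \<chi>\<psi> \<rho>\<sigma> fa by simp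
      then show ?thesis using a fa by simp
    qed (rule one)
  next
    fix u v assume "u \<in> words A" "v \<in> words A" "wev H f u = wev H f v"
    then show "gcl A R' u = gcl A R' v" using \<eta>w by metis
  qed
qed

text \<open>Sending the letters outside \<open>X\<close> to \<open>1\<close> defines a homomorphism back to the group on \<open>X\<close>, since
  it leaves the relators alone.\<close>

lemma gcl_subalphabet:
  assumes XA: "X \<subseteq> A" and R: "R \<subseteq> words X" and uv: "u \<in> words X" "v \<in> words X"
    and eq: "gcl A R u = gcl A R v"
  shows "gcl X R u = gcl X R v"
proof -
  have wA: "w \<in> words A" if "w \<in> words X" for w using that XA by (auto simp: words_iff)
  interpret P: group "group_pres X R" by (rule group_group_pres[OF R])
  let ?f = "\<lambda>a. if a \<in> X then gcl X R [(a, True)] else \<one>\<^bsub>group_pres X R\<^esub>"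
  have f: "?f \<in> A \<rightarrow> carrier (group_pres X R)" by (auto intro!: gcl_closed)
  have w: "wev (group_pres X R) ?f w = gcl X R w" if "w \<in> words X" for w
    using gcl_eq_wev[OF R that] wev_cong[OF that, of ?f "\<lambda>a. gcl X R [(a, True)]"] by simp
  have "wev (group_pres X R) ?f r = \<one>\<^bsub>group_pres X R\<^esub>" if "r \<in> R" for r
    using w[of r] pcl_relator[OF R that, of "free_reduction X"] that R by (auto simp: one_group_pres)
  then show ?thesis
    using P.gcl_eq_imp_wev_eq[OF f _ _ wA[OF uv(1)] wA[OF uv(2)] eq] R wA uv w by auto
qed

lemma generate_subalphabet_iso:
  assumes XA: "X \<subseteq> A" and R: "R \<subseteq> words X" and S: "S \<subseteq> words X"
  shows "(group_pres X R)\<lparr>carrier := generate (group_pres X R) (gcl X R ` S)\<rparr> \<cong>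
         (group_pres A R)\<lparr>carrier := generate (group_pres A R) (gcl A R ` S)\<rparr>"
proof -
  have wA: "w \<in> words A" if "w \<in> words X" for w using that XA by (auto simp: words_iff)
  then have RA: "R \<subseteq> words A" using R by blast
  interpret P: group "group_pres X R" by (rule group_group_pres[OF R])
  interpret A: group "group_pres A R" by (rule group_group_pres[OF RA])
  let ?f = "\<lambda>a. gcl A R [(a, True)]"
  have f: "?f \<in> X \<rightarrow> carrier (group_pres A R)" using XA by (auto intro!: gcl_closed)
  have w: "wev (group_pres A R) ?f w = gcl A R w" if "w \<in> words X" for w
    using gcl_eq_wev[OF RA wA[OF that]] by simp
  have rel: "wev (group_pres A R) ?f r = \<one>\<^bsub>group_pres A R\<^esub>" if "r \<in> R" for r
    using w[of r] pcl_relator[OF RA that, of "free_reduction A"] that R by (auto simp: one_group_pres)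
  obtain h where h: "h \<in> hom (group_pres X R) (group_pres A R)"
    and hw: "\<And>u. u \<in> words X \<Longrightarrow> h (gcl X R u) = wev (group_pres A R) ?f u"
    using A.group_pres_lift[OF f R rel] by blast
  have hg: "h (gcl X R u) = gcl A R u" if "u \<in> words X" for u
    using hw w that by simp
  interpret h: group_hom "group_pres X R" "group_pres A R" h
    using h by unfold_locales
  have inj: "inj_on h (carrier (group_pres X R))"
  proof (rule inj_onI)
    fix x y assume "x \<in> carrier (group_pres X R)" "y \<in> carrier (group_pres X R)" and e: "h x = h y"
    then obtain u v where "u \<in> words X" "v \<in> words X" "x = gcl X R u" "y = gcl X R v"
      by (auto simp: carrier_group_pres)
    then show "x = y" using e gcl_subalphabet[OF XA R, of u v] by (simp add: hg)
  qed
  have c: "gcl X R ` S \<subseteq> carrier (group_pres X R)" using S gcl_closed by blast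
  have "gcl A R ` S = h ` gcl X R ` S" using S hg by (force simp: image_image)
  then have img: "generate (group_pres A R) (gcl A R ` S) = h ` generate (group_pres X R) (gcl X R ` S)"
    using h.generate_img[OF c] by simp
  let ?V = "generate (group_pres X R) (gcl X R ` S)"
  have V: "?V \<subseteq> carrier (group_pres X R)" by (rule P.generate_incl[OF c])
  have "h \<in> iso ((group_pres X R)\<lparr>carrier := ?V\<rparr>) ((group_pres A R)\<lparr>carrier := h ` ?V\<rparr>)"
    using V inj_on_subset[OF inj V] by (auto simp: iso_def hom_def bij_betw_def subset_iff)
  then show ?thesis unfolding img by (auto simp: is_iso_def)
qed

section \<open>Inverse monoids and their natural order\<close>

locale inverse_monoid = monoid +
  assumes regular: "x \<in> carrier G \<Longrightarrow> \<exists>y\<in>carrier G. x \<otimes> y \<otimes> x = x \<and> y \<otimes> x \<otimes> y = y"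
    and idem_comm: "idempotent_elt G e \<Longrightarrow> idempotent_elt G f \<Longrightarrow> e \<otimes> f = f \<otimes> e"
begin

definition below :: "'a \<Rightarrow> 'a \<Rightarrow> bool" where
  "below x y \<longleftrightarrow> y \<in> carrier G \<and> (\<exists>e. idempotent_elt G e \<and> x = e \<otimes> y)"

lemma idem_closed: "idempotent_elt G e \<Longrightarrow> e \<in> carrier G"
  by (simp add: idempotent_elt_def)

lemma idem_one: "idempotent_elt G \<one>"
  by (simp add: idempotent_elt_def)

lemma idem_mult:
  assumes "idempotent_elt G e" "idempotent_elt G f" shows "idempotent_elt G (e \<otimes> f)"
proof -
  have c: "e \<in> carrier G" "f \<in> carrier G" and i: "e \<otimes> e = e" "f \<otimes> f = f"
    using assms by (auto simp: idempotent_elt_def)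
  have "e \<otimes> f \<otimes> (e \<otimes> f) = e \<otimes> (f \<otimes> e) \<otimes> f" using c by (simp add: m_assoc)
  also have "\<dots> = e \<otimes> (e \<otimes> f) \<otimes> f" using idem_comm[OF assms] by simp
  also have "\<dots> = (e \<otimes> e) \<otimes> (f \<otimes> f)" using c by (simp add: m_assoc)
  finally show ?thesis using c i by (simp add: idempotent_elt_def)
qed

lemma idem_inverse_pair:
  assumes "x \<in> carrier G" "y \<in> carrier G" "x \<otimes> y \<otimes> x = x"
  shows "idempotent_elt G (x \<otimes> y)"
  using assms by (simp add: idempotent_elt_def flip: m_assoc)

lemma idem_right_invertible:
  assumes "idempotent_elt G e" "y \<in> carrier G" "e \<otimes> y = \<one>" shows "e = \<one>"
  using m_assoc[of e e y] assms by (simp add: idempotent_elt_def)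

lemma idem_left_invertible:
  assumes "idempotent_elt G e" "y \<in> carrier G" "y \<otimes> e = \<one>" shows "e = \<one>"
  using m_assoc[of y e e] assms by (simp add: idempotent_elt_def)

text \<open>Take \<open>f = x e y\<close> for an inverse \<open>y\<close> of \<open>x\<close>. This makes the natural order \<open>below\<close>
  compatible with multiplication.\<close>

lemma move_idem_left:
  assumes x: "x \<in> carrier G" and e: "idempotent_elt G e"
  obtains f where "idempotent_elt G f" "x \<otimes> e = f \<otimes> x"
proof -
  obtain y where y: "y \<in> carrier G" "x \<otimes> y \<otimes> x = x" "y \<otimes> x \<otimes> y = y" using regular[OF x] by blast
  have ec: "e \<in> carrier G" "e \<otimes> e = e" using e by (auto simp: idempotent_elt_def)
  have yx: "idempotent_elt G (y \<otimes> x)" by (rule idem_inverse_pair) (use x y in auto)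
  have "x \<otimes> e \<otimes> y \<otimes> x = x \<otimes> (e \<otimes> (y \<otimes> x))" using x y ec by (simp add: m_assoc)
  also have "\<dots> = x \<otimes> ((y \<otimes> x) \<otimes> e)" using idem_comm[OF e yx] by simp
  also have "\<dots> = (x \<otimes> y \<otimes> x) \<otimes> e" using x y(1) ec by (simp add: m_assoc)
  finally have m: "x \<otimes> e \<otimes> y \<otimes> x = x \<otimes> e" using y by simp
  have "x \<otimes> e \<otimes> y \<otimes> (x \<otimes> e \<otimes> y) = (x \<otimes> e \<otimes> y \<otimes> x) \<otimes> e \<otimes> y" using x y ec by (simp add: m_assoc)
  also have "\<dots> = x \<otimes> (e \<otimes> e) \<otimes> y" unfolding m using x y ec by (simp add: m_assoc)
  finally have "idempotent_elt G (x \<otimes> e \<otimes> y)" using x y ec by (simp add: idempotent_elt_def)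
  then show ?thesis using m that[of "x \<otimes> e \<otimes> y"] by simp
qed

lemma below_refl: "x \<in> carrier G \<Longrightarrow> below x x"
  unfolding below_def using idem_one by (intro conjI exI[of _ \<one>]) auto

lemma below_closed: "below x y \<Longrightarrow> x \<in> carrier G \<and> y \<in> carrier G"
  by (auto simp: below_def idempotent_elt_def)

lemma below_one_iff: "below x \<one> \<longleftrightarrow> idempotent_elt G x"
  by (auto simp: below_def idempotent_elt_def)

lemma below_trans: "below x y \<Longrightarrow> below y z \<Longrightarrow> below x z"
  unfolding below_def by (metis idem_mult idem_closed m_assoc)

lemma below_mult:
  assumes "below x y" "below x' y'" shows "below (x \<otimes> x') (y \<otimes> y')"
proof -
  obtain e f where e: "idempotent_elt G e" "x = e \<otimes> y" and f: "idempotent_elt G f" "x' = f \<otimes> y'"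
    and c: "y \<in> carrier G" "y' \<in> carrier G"
    using assms by (auto simp: below_def)
  obtain g where g: "idempotent_elt G g" "y \<otimes> f = g \<otimes> y" using move_idem_left[OF c(1) f(1)] by blast
  have "x \<otimes> x' = e \<otimes> (y \<otimes> f) \<otimes> y'" using e f c by (simp add: m_assoc idem_closed)
  also have "\<dots> = (e \<otimes> g) \<otimes> (y \<otimes> y')" using e g c by (simp add: m_assoc idem_closed)
  finally show ?thesis unfolding below_def using c idem_mult[OF e(1) g(1)] by blast
qed

text \<open>If \<open>m = e y\<close> and \<open>n = f y\<close> with idempotents \<open>e\<close> and \<open>f\<close>, then \<open>f m = e n\<close> lies below both
  \<open>m\<close> and \<open>n\<close>.\<close>

lemma lower_bound_trans:
  assumes "below m x" "below m y" "below n y" "below n z"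
  shows "\<exists>k. below k x \<and> below k z"
proof -
  obtain e f where e: "idempotent_elt G e" "m = e \<otimes> y" and f: "idempotent_elt G f" "n = f \<otimes> y"
    and y: "y \<in> carrier G"
    using assms by (auto simp: below_def)
  have "f \<otimes> m = e \<otimes> n"
    using e f y idem_comm[OF e(1) f(1)] by (simp add: idem_closed flip: m_assoc)
  moreover have "below (f \<otimes> m) m" "below (e \<otimes> n) n"
    using e(1) f(1) below_closed[OF assms(1)] below_closed[OF assms(3)] by (auto simp: below_def)
  ultimately show ?thesis using assms below_trans by metis
qed

end

section \<open>Special inverse monoids\<close>

lemma carrier_special_inv: "carrier (special_inv A R) = icl A R ` words A"
  by (simp add: special_inv_eq_pres carrier_pres)

lemma icl_closed: "u \<in> words A \<Longrightarrow> icl A R u \<in> carrier (special_inv A R)"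
  by (simp add: carrier_special_inv)

lemma one_special_inv: "\<one>\<^bsub>special_inv A R\<^esub> = icl A R []"
  by (simp add: special_inv_eq_pres one_pres)

lemma icl_append:
  "u \<in> words A \<Longrightarrow> v \<in> words A \<Longrightarrow>
    icl A R (u @ v) = icl A R u \<otimes>\<^bsub>special_inv A R\<^esub> icl A R v"
  by (simp add: special_inv_eq_pres pcl_append)

lemma icl_inverse_pair:
  assumes "R \<subseteq> words A" "u \<in> words A"
  shows "icl A R (u @ winv u @ u) = icl A R u"
  by (rule pcl_base) (use assms in \<open>auto simp: wagner_def\<close>)

lemma icl_idem_comm:
  assumes "R \<subseteq> words A" "u \<in> words A" "v \<in> words A"
  shows "icl A R (u @ winv u @ v @ winv v) = icl A R (v @ winv v @ u @ winv u)"
  by (rule pcl_base) (use assms in \<open>auto simp: wagner_def\<close>)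

text \<open>Wagner's relations only make the products of a word with its formal inverse commute. An
  idempotent \<open>e\<close> with inverse \<open>y\<close> is of this form: commuting gives
  \<open>y = y e e y = (y e)(e y) = (e y)(y e)\<close>, and substituting this for \<open>y\<close> in \<open>e = e y e\<close> gives
  \<open>e = (e y)(y e)\<close> as well, so that \<open>e = y\<close> and \<open>e = e e = e y\<close>.\<close>

lemma inverse_monoid_special_inv:
  assumes R: "R \<subseteq> words A" shows "inverse_monoid (special_inv A R)"
proof -
  let ?M = "special_inv A R"
  interpret monoid ?M using monoid_pres[of A "wagner A" R] by (simp add: special_inv_eq_pres)
  have pair: "icl A R u \<otimes>\<^bsub>?M\<^esub> icl A R (winv u) \<otimes>\<^bsub>?M\<^esub> icl A R u = icl A R u" if "u \<in> words A" for u
    using icl_inverse_pair[OF R that] that by (simp add: icl_append icl_closed m_assoc)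
  have idem: "\<exists>u\<in>words A. e = icl A R (u @ winv u)" if e: "idempotent_elt ?M e" for e
  proof -
    obtain u where u: "u \<in> words A" "e = icl A R u"
      using e by (auto simp: idempotent_elt_def carrier_special_inv)
    let ?y = "icl A R (winv u)"
    have ee: "e \<otimes>\<^bsub>?M\<^esub> e = e" using e by (simp add: idempotent_elt_def)
    have c: "e \<in> carrier ?M" "?y \<in> carrier ?M" using u by (auto simp: icl_closed)
    have p: "e \<otimes>\<^bsub>?M\<^esub> ?y \<otimes>\<^bsub>?M\<^esub> e = e" "?y \<otimes>\<^bsub>?M\<^esub> e \<otimes>\<^bsub>?M\<^esub> ?y = ?y"
      using pair[of u] pair[of "winv u"] u by auto
    have comm: "(?y \<otimes>\<^bsub>?M\<^esub> e) \<otimes>\<^bsub>?M\<^esub> (e \<otimes>\<^bsub>?M\<^esub> ?y) = (e \<otimes>\<^bsub>?M\<^esub> ?y) \<otimes>\<^bsub>?M\<^esub> (?y \<otimes>\<^bsub>?M\<^esub> e)"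
      using icl_idem_comm[OF R u(1), of "winv u"] u by (simp add: icl_append icl_closed m_assoc)
    have "?y = ?y \<otimes>\<^bsub>?M\<^esub> (e \<otimes>\<^bsub>?M\<^esub> e) \<otimes>\<^bsub>?M\<^esub> ?y" using p ee by simp
    also have "\<dots> = (?y \<otimes>\<^bsub>?M\<^esub> e) \<otimes>\<^bsub>?M\<^esub> (e \<otimes>\<^bsub>?M\<^esub> ?y)" using c by (simp add: m_assoc)
    finally have y1: "?y = (?y \<otimes>\<^bsub>?M\<^esub> e) \<otimes>\<^bsub>?M\<^esub> (e \<otimes>\<^bsub>?M\<^esub> ?y)" .
    then have y2: "?y = (e \<otimes>\<^bsub>?M\<^esub> ?y) \<otimes>\<^bsub>?M\<^esub> (?y \<otimes>\<^bsub>?M\<^esub> e)" using comm by simp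
    have "e = e \<otimes>\<^bsub>?M\<^esub> ?y \<otimes>\<^bsub>?M\<^esub> e" using p by simp
    also have "\<dots> = e \<otimes>\<^bsub>?M\<^esub> ((e \<otimes>\<^bsub>?M\<^esub> ?y) \<otimes>\<^bsub>?M\<^esub> (?y \<otimes>\<^bsub>?M\<^esub> e)) \<otimes>\<^bsub>?M\<^esub> e" using y2 by simp
    also have "\<dots> = (e \<otimes>\<^bsub>?M\<^esub> e) \<otimes>\<^bsub>?M\<^esub> ?y \<otimes>\<^bsub>?M\<^esub> ?y \<otimes>\<^bsub>?M\<^esub> (e \<otimes>\<^bsub>?M\<^esub> e)" using c by (simp add: m_assoc)
    also have "\<dots> = (e \<otimes>\<^bsub>?M\<^esub> ?y) \<otimes>\<^bsub>?M\<^esub> (?y \<otimes>\<^bsub>?M\<^esub> e)" using c ee by (simp add: m_assoc)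
    finally have "e = ?y" using y2 by simp
    then have "e = e \<otimes>\<^bsub>?M\<^esub> ?y" using ee by simp
    then show ?thesis using u by (auto simp: icl_append)
  qed
  show ?thesis
  proof unfold_locales
    fix x assume "x \<in> carrier ?M"
    then obtain u where u: "u \<in> words A" "x = icl A R u" by (auto simp: carrier_special_inv)
    then show "\<exists>y\<in>carrier ?M. x \<otimes>\<^bsub>?M\<^esub> y \<otimes>\<^bsub>?M\<^esub> x = x \<and> y \<otimes>\<^bsub>?M\<^esub> x \<otimes>\<^bsub>?M\<^esub> y = y"
      using pair[of u] pair[of "winv u"] by (intro bexI[of _ "icl A R (winv u)"]) (auto simp: icl_closed)
  next
    fix e f assume "idempotent_elt ?M e" "idempotent_elt ?M f"
    then obtain u v where "u \<in> words A" "e = icl A R (u @ winv u)" "v \<in> words A" "f = icl A R (v @ winv v)"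
      using idem by blast
    then show "e \<otimes>\<^bsub>?M\<^esub> f = f \<otimes>\<^bsub>?M\<^esub> e"
      using icl_idem_comm[OF R, of u v] by (simp flip: icl_append)
  qed
qed

lemma icl_eq_imp_gcl_eq:
  assumes R: "R \<subseteq> words A" and uv: "u \<in> words A" "v \<in> words A" and eq: "icl A R u = icl A R v"
  shows "gcl A R u = gcl A R v"
proof -
  interpret P: group "group_pres A R" by (rule group_group_pres[OF R])
  have "(u, v) \<in> gen_cong (word_monoid A) (rels (wagner A) R)"
    using R uv eq by (simp add: pcl_eq_iff)
  then show ?thesis
  proof induction
    case (base x y)
    have i: "gcl A R (winv w) = inv\<^bsub>group_pres A R\<^esub> gcl A R w" if "w \<in> words A" for w
      using inv_gcl[OF R that] by simp
    show ?case
    proof (cases "(x, y) \<in> wagner A")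
      case True
      then show ?thesis
        by (auto simp: wagner_def gcl_append i gcl_closed)
    next
      case False
      then show ?thesis using base pcl_relator[OF R] by auto
    qed
  next
    case (mult x y x' y')
    then show ?case
      using gen_cong_words[OF mult.hyps(1)] gen_cong_words[OF mult.hyps(2)] by (simp add: gcl_append)
  qed simp_all
qed

text \<open>The group with the same presentation is the maximal group image of the inverse monoid:
  having a common lower bound is a congruence that contains the free reductions.\<close>

lemma gcl_eq_imp_lower_bound:
  assumes R: "R \<subseteq> words A" and uv: "u \<in> words A" "v \<in> words A" and eq: "gcl A R u = gcl A R v"
  shows "\<exists>m. inverse_monoid.below (special_inv A R) m (icl A R u) \<and>
             inverse_monoid.below (special_inv A R) m (icl A R v)"
proof -
  interpret M: inverse_monoid "special_inv A R" by (rule inverse_monoid_special_inv[OF R])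
  have "(u, v) \<in> gen_cong (word_monoid A) (rels (free_reduction A) R)"
    using R uv eq by (simp add: pcl_eq_iff)
  then show ?thesis
  proof induction
    case (base x y)
    then show ?case
    proof (cases "(x, y) \<in> free_reduction A")
      case True
      then obtain w where w: "w \<in> words A" "x = w @ winv w" "y = []" by (auto simp: free_reduction_def)
      have "idempotent_elt (special_inv A R) (icl A R x)"
        unfolding w(2) icl_append[OF w(1) winv_in_words[THEN iffD2, OF w(1)]]
        by (rule M.idem_inverse_pair)
          (use w icl_inverse_pair[OF R w(1)] in \<open>auto simp: icl_closed simp flip: icl_append\<close>)
      then show ?thesis using w M.below_refl[of "icl A R x"] M.below_one_iff[of "icl A R x"]
        by (auto simp: one_special_inv M.idem_closed)
    next
      case False
      then have "icl A R x = icl A R y" using base pcl_relator[OF R, of x "wagner A"] by auto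
      then show ?thesis using base M.below_refl[of "icl A R y"] by (auto simp: icl_closed)
    qed
  next
    case (refl x)
    then show ?case using M.below_refl[of "icl A R x"] by (auto simp: icl_closed)
  next
    case (trans x y z)
    then show ?case using M.lower_bound_trans by blast
  next
    case (mult x y x' y')
    then show ?case
      using gen_cong_words[OF mult.hyps(1)] gen_cong_words[OF mult.hyps(2)]
      by (auto simp: icl_append intro: M.below_mult)
  qed blast
qed

section \<open>Partial actions of words\<close>

text \<open>Restricting an action of words to a subset \<open>N\<close> of the points, including all intermediate
  points, makes it partial. This is what lets non-units act.\<close>

fun walk :: "('l \<Rightarrow> 'n \<Rightarrow> 'n) \<Rightarrow> 'n set \<Rightarrow> 'l list \<Rightarrow> 'n \<Rightarrow> 'n option" where
  "walk \<delta> N [] n = (if n \<in> N then Some n else None)"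
| "walk \<delta> N (l # u) n = (if n \<in> N then walk \<delta> N u (\<delta> l n) else None)"

lemma walk_in: "walk \<delta> N u n = Some m \<Longrightarrow> n \<in> N \<and> m \<in> N"
  by (induction u arbitrary: n) (auto split: if_splits)

lemma walk_append: "walk \<delta> N (u @ v) n = Option.bind (walk \<delta> N u n) (walk \<delta> N v)"
proof (induction u arbitrary: n)
  case Nil
  then show ?case using walk_in[of \<delta> N v n] by (cases "walk \<delta> N v n") auto
qed simp

lemma walk_fold: "walk \<delta> N u n = Some m \<Longrightarrow> m = fold \<delta> u n"
  by (induction u arbitrary: n) (auto split: if_splits)

locale letter_action =
  fixes A :: "'a set" and \<delta> :: "'a \<times> bool \<Rightarrow> 'n \<Rightarrow> 'n" and \<Omega> :: "'n set"
  assumes act_closed: "a \<in> A \<Longrightarrow> n \<in> \<Omega> \<Longrightarrow> \<delta> (a, b) n \<in> \<Omega>"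
    and act_inverse: "a \<in> A \<Longrightarrow> n \<in> \<Omega> \<Longrightarrow> \<delta> (a, \<not> b) (\<delta> (a, b) n) = n"
begin

lemma fold_closed: "u \<in> words A \<Longrightarrow> n \<in> \<Omega> \<Longrightarrow> fold \<delta> u n \<in> \<Omega>"
  by (induction u arbitrary: n) (auto simp: act_closed)

lemma walk_total: "u \<in> words A \<Longrightarrow> n \<in> \<Omega> \<Longrightarrow> walk \<delta> \<Omega> u n = Some (fold \<delta> u n)"
  by (induction u arbitrary: n) (auto simp: act_closed)

lemma walk_winv:
  assumes "N \<subseteq> \<Omega>" "u \<in> words A"
  shows "walk \<delta> N (winv u) m = Some n \<longleftrightarrow> walk \<delta> N u n = Some m"
  using assms(2)
proof (induction u arbitrary: n)
  case (Cons l u)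
  obtain a b where l: "l = (a, b)" "a \<in> A" using Cons.prems by (cases l) auto
  have "walk \<delta> N (winv (l # u)) m = Some n \<longleftrightarrow>
      (\<exists>k. walk \<delta> N (winv u) m = Some k \<and> k \<in> N \<and> \<delta> (a, \<not> b) k = n \<and> n \<in> N)"
    by (auto simp: l walk_append bind_eq_Some_conv split: if_splits)
  also have "\<dots> \<longleftrightarrow> (\<exists>k. walk \<delta> N u k = Some m \<and> k \<in> N \<and> \<delta> (a, \<not> b) k = n \<and> n \<in> N)"
    using Cons by simp
  also have "\<dots> \<longleftrightarrow> n \<in> N \<and> walk \<delta> N u (\<delta> (a, b) n) = Some m"
    using act_inverse[of a _ b] act_inverse[of a _ "\<not> b"] l assms(1) walk_in[of \<delta> N u _ m]
    by (auto simp: subset_iff)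
  finally show ?case by (simp add: l)
qed auto

text \<open>Words act on \<open>N\<close> by partial injections in which formally inverse words act as inverses,
  so Wagner's relations hold for this action.\<close>

lemma icl_eq_imp_walk_eq:
  assumes N: "N \<subseteq> \<Omega>" and R: "R \<subseteq> words A" "\<And>r n. r \<in> R \<Longrightarrow> n \<in> N \<Longrightarrow> walk \<delta> N r n = Some n"
    and uv: "u \<in> words A" "v \<in> words A" and eq: "icl A R u = icl A R v" and n: "n \<in> N"
  shows "walk \<delta> N u n = walk \<delta> N v n"
proof -
  have aa: "walk \<delta> N (w @ winv w) k = (if walk \<delta> N w k = None then None else Some k)"
    if "w \<in> words A" for w k
    using walk_winv[OF N that] by (cases "walk \<delta> N w k") (auto simp: walk_append)
  have aaa: "walk \<delta> N (w @ winv w @ w) k = walk \<delta> N w k" if "w \<in> words A" for w k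
    using aa[OF that] walk_append[of \<delta> N "w @ winv w" w k] by simp
  have "(u, v) \<in> gen_cong (word_monoid A) (rels (wagner A) R)"
    using R uv eq by (simp add: pcl_eq_iff)
  then have "\<forall>n\<in>N. walk \<delta> N u n = walk \<delta> N v n"
  proof induction
    case (base x y)
    show ?case
    proof (cases "(x, y) \<in> wagner A")
      case True
      have "walk \<delta> N (w @ winv w @ w' @ winv w') k = walk \<delta> N (w' @ winv w' @ w @ winv w) k"
        if "w \<in> words A" "w' \<in> words A" for w w' k
        using aa[OF that(1)] aa[OF that(2)]
          walk_append[of \<delta> N "w @ winv w" "w' @ winv w'" k] walk_append[of \<delta> N "w' @ winv w'" "w @ winv w" k]
        by simp
      then show ?thesis using True aaa by (auto simp: wagner_def)
    next
      case False
      then show ?thesis using base R(2) by auto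
    qed
  next
    case (mult x y x' y')
    have "Option.bind (walk \<delta> N y k) (walk \<delta> N x') = Option.bind (walk \<delta> N y k) (walk \<delta> N y')" for k
      using mult.IH(2) walk_in[of \<delta> N y k] by (cases "walk \<delta> N y k") auto
    then show ?case using mult.IH(1) by (simp add: walk_append)
  qed auto
  then show ?thesis using n by blast
qed

text \<open>The product acts as the identity of \<open>N\<close>, so its first factor is defined everywhere on \<open>N\<close>.\<close>

lemma right_invertible_imp_walk:
  assumes "N \<subseteq> \<Omega>" "R \<subseteq> words A" "\<And>r n. r \<in> R \<Longrightarrow> n \<in> N \<Longrightarrow> walk \<delta> N r n = Some n"
    and uv: "u \<in> words A" "v \<in> words A"
    and inv: "icl A R u \<otimes>\<^bsub>special_inv A R\<^esub> icl A R v = \<one>\<^bsub>special_inv A R\<^esub>" and n: "n \<in> N"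
  shows "walk \<delta> N u n = Some (fold \<delta> u n)"
proof -
  have "walk \<delta> N (u @ v) n = walk \<delta> N [] n"
    by (rule icl_eq_imp_walk_eq[OF assms(1-3)]) (use uv inv n in \<open>auto simp: icl_append one_special_inv\<close>)
  then obtain m where "walk \<delta> N u n = Some m" using n by (auto simp: walk_append bind_eq_Some_conv)
  then show ?thesis using walk_fold by metis
qed

end

section \<open>Units of an \<open>E\<close>-unitary one-relator special inverse monoid\<close>

text \<open>Coherence of one-relator groups over finite alphabets covers an infinite alphabet \<open>A\<close> as
  well: the subgroup generated by \<open>S\<close> already sits in the group on the letters of \<open>r\<close> and \<open>S\<close>.\<close>

lemma finitely_presented_generate:
  fixes A :: "'a set"
  assumes coh: "\<forall>(A :: 'a set) r. r \<in> words A \<longrightarrow>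
      finitely_presented (group_pres A {r}) \<longrightarrow> coherent (group_pres A {r})"
    and r: "r \<in> words A" and S: "finite S" "S \<subseteq> words A"
  shows "finitely_presented ((group_pres A {r})\<lparr>carrier := generate (group_pres A {r}) (gcl A {r} ` S)\<rparr>)"
proof -
  define X where "X = (\<Union>w\<in>insert r S. fst ` set w)"
  have fin: "finite X" and XA: "X \<subseteq> A" and rX: "{r} \<subseteq> words X" and SX: "S \<subseteq> words X"
    using r S unfolding X_def words_iff subset_iff by blast+
  interpret P: group "group_pres X {r}" by (rule group_group_pres[OF rX])
  interpret A: group "group_pres A {r}" by (rule group_group_pres) (use r in simp)
  let ?V = "generate (group_pres X {r}) (gcl X {r} ` S)"
  let ?W = "generate (group_pres A {r}) (gcl A {r} ` S)"
  have c: "gcl X {r} ` S \<subseteq> carrier (group_pres X {r})" using SX gcl_closed by blast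
  have cA: "gcl A {r} ` S \<subseteq> carrier (group_pres A {r})" using S gcl_closed by blast
  have sub: "subgroup ?V (group_pres X {r})" by (rule P.generate_is_subgroup[OF c])
  have grp: "group ((group_pres X {r})\<lparr>carrier := ?V\<rparr>)" by (rule P.subgroup_imp_group[OF sub])
  have incl: "gcl X {r} ` S \<subseteq> ?V" by (auto intro: generate.incl)
  have "generate ((group_pres X {r})\<lparr>carrier := ?V\<rparr>) (gcl X {r} ` S) = ?V"
    by (rule P.generate_consistent[OF incl sub])
  then have "finitely_generated ((group_pres X {r})\<lparr>carrier := ?V\<rparr>)"
    unfolding finitely_generated_def using grp incl S(1)
    by (intro conjI exI[of _ "gcl X {r} ` S"]) auto
  moreover have "coherent (group_pres X {r})"
    using coh rX finitely_presented_group_pres[OF fin _ rX] by simp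
  ultimately have fp: "finitely_presented ((group_pres X {r})\<lparr>carrier := ?V\<rparr>)"
    using sub unfolding coherent_def by blast
  have "(group_pres X {r})\<lparr>carrier := ?V\<rparr> \<cong> (group_pres A {r})\<lparr>carrier := ?W\<rparr>"
    by (rule generate_subalphabet_iso[OF XA rX SX])
  then show ?thesis
    using finitely_presented_iso[OF A.subgroup_imp_group[OF A.generate_is_subgroup[OF cA]]
        group.iso_sym[OF grp] fp] by blast
qed

locale E_unitary_one_relator =
  fixes A :: "'a set" and r :: "'a word"
  assumes r: "r \<in> words A" and E_unitary: "E_unitary (special_inv A {r})"
begin

abbreviation "M \<equiv> special_inv A {r}"
abbreviation "G \<equiv> group_pres A {r}"
abbreviation "g \<equiv> gcl A {r}"
abbreviation "i \<equiv> icl A {r}"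

sublocale G: group G by (rule group_group_pres) (use r in simp)
sublocale M: inverse_monoid M by (rule inverse_monoid_special_inv) (use r in simp)

definition prefixes_r :: "'a word set" where "prefixes_r = {p. \<exists>q. r = p @ q}"

text \<open>This is the image in \<open>G\<close> of the submonoid of right invertible elements of \<open>M\<close>.\<close>

definition N where "N = {g (concat ps) |ps. set ps \<subseteq> prefixes_r}"

text \<open>The group of units of \<open>N\<close>.\<close>

definition V where "V = {x \<in> N. inv\<^bsub>G\<^esub> x \<in> N}"

lemma prefixes_words: "p \<in> prefixes_r \<Longrightarrow> p \<in> words A"
  using r by (auto simp: prefixes_r_def)

lemma finite_prefixes: "finite prefixes_r"
proof -
  have "prefixes_r \<subseteq> (\<lambda>k. take k r) ` {..length r}"
  proof
    fix p assume "p \<in> prefixes_r"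
    then show "p \<in> (\<lambda>k. take k r) ` {..length r}"
      by (intro image_eqI[where x = "length p"]) (auto simp: prefixes_r_def)
  qed
  then show ?thesis by (rule finite_subset) simp
qed

lemma concat_words: "set ps \<subseteq> prefixes_r \<Longrightarrow> concat ps \<in> words A"
  by (induction ps) (auto simp: prefixes_words)

lemma N_closed: "x \<in> N \<Longrightarrow> x \<in> carrier G"
  by (auto simp: N_def intro!: gcl_closed concat_words)

lemma N_one: "\<one>\<^bsub>G\<^esub> \<in> N"
  unfolding N_def one_group_pres by (intro CollectI exI[of _ "[]"]) simp

lemma N_mult: assumes "x \<in> N" "y \<in> N" shows "x \<otimes>\<^bsub>G\<^esub> y \<in> N"
proof -
  obtain ps qs where "set ps \<subseteq> prefixes_r" "x = g (concat ps)" "set qs \<subseteq> prefixes_r" "y = g (concat qs)"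
    using assms by (auto simp: N_def)
  then show ?thesis unfolding N_def
    by (intro CollectI exI[of _ "ps @ qs"]) (simp add: gcl_append concat_words)
qed

lemma N_prefix: "p \<in> prefixes_r \<Longrightarrow> g p \<in> N"
  unfolding N_def by (intro CollectI exI[of _ "[p]"]) simp

definition \<delta> where "\<delta> l x = x \<otimes>\<^bsub>G\<^esub> g [l]"

sublocale letter_action A \<delta> "carrier G"
proof
  fix a b x assume a: "a \<in> A" and x: "x \<in> carrier G"
  then show "\<delta> (a, b) x \<in> carrier G" by (simp add: \<delta>_def gcl_closed)
  have "g [(a, \<not> b)] = inv\<^bsub>G\<^esub> g [(a, b)]"
    using inv_gcl[of "{r}" A "[(a, b)]"] a r by simp
  then show "\<delta> (a, \<not> b) (\<delta> (a, b) x) = x"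
    using a x by (simp add: \<delta>_def gcl_closed G.m_assoc)
qed

lemma fold_eq: "u \<in> words A \<Longrightarrow> x \<in> carrier G \<Longrightarrow> fold \<delta> u x = x \<otimes>\<^bsub>G\<^esub> g u"
proof (induction u arbitrary: x)
  case Nil
  then show ?case by (simp flip: one_group_pres)
next
  case (Cons l u)
  then show ?case by (cases l) (simp add: \<delta>_def gcl_closed gcl_Cons[of _ A u] G.m_assoc)
qed

text \<open>The walk along \<open>u\<close> from \<open>x\<close> visits exactly the elements \<open>x p\<close> for the prefixes \<open>p\<close> of \<open>u\<close>.\<close>

lemma walk_eq:
  "u \<in> words A \<Longrightarrow> x \<in> carrier G \<Longrightarrow> (\<And>p q. u = p @ q \<Longrightarrow> x \<otimes>\<^bsub>G\<^esub> g p \<in> N) \<Longrightarrow>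
    walk \<delta> N u x = Some (fold \<delta> u x)"
proof (induction u arbitrary: x)
  case Nil
  then show ?case using Nil(3)[of "[]" "[]"] by (simp flip: one_group_pres)
next
  case (Cons l u)
  have x: "x \<in> N" using Cons.prems(2) Cons.prems(3)[of "[]" "l # u"] by (simp flip: one_group_pres)
  have "walk \<delta> N u (\<delta> l x) = Some (fold \<delta> u (\<delta> l x))"
  proof (rule Cons.IH)
    show "\<delta> l x \<in> carrier G" using Cons.prems by (cases l) (simp add: act_closed)
    fix p q assume "u = p @ q"
    then show "\<delta> l x \<otimes>\<^bsub>G\<^esub> g p \<in> N"
      using Cons.prems(1,2) Cons.prems(3)[of "l # p" q]
      by (cases l) (simp add: \<delta>_def gcl_closed gcl_Cons[of _ A p] G.m_assoc)
  qed (use Cons.prems in simp)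
  then show ?case using x by simp
qed

text \<open>The relator acts as the identity on \<open>N\<close>, since \<open>N\<close> is closed under multiplication by its
  prefixes. Hence \<open>M\<close> acts on \<open>N\<close>, and a right invertible element takes \<open>1 \<in> N\<close> to a point
  of \<open>N\<close>.\<close>

lemma right_invertible_in_N:
  assumes "u \<in> words A" "v \<in> words A" "i u \<otimes>\<^bsub>M\<^esub> i v = \<one>\<^bsub>M\<^esub>"
  shows "g u \<in> N"
proof -
  have "walk \<delta> N r' n = Some n" if "r' \<in> {r}" "n \<in> N" for r' n
  proof -
    have "walk \<delta> N r n = Some (fold \<delta> r n)"
    proof (rule walk_eq[OF r N_closed[OF that(2)]])
      fix p q assume "r = p @ q"
      then have "p \<in> prefixes_r" unfolding prefixes_r_def by blast
      then show "n \<otimes>\<^bsub>G\<^esub> g p \<in> N" using that(2) by (intro N_mult N_prefix)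
    qed
    also have "fold \<delta> r n = n"
      using fold_eq[OF r N_closed[OF that(2)]] pcl_relator[of "{r}" A r "free_reduction A"] r N_closed[OF that(2)]
      by (simp flip: one_group_pres)
    finally show ?thesis using that by simp
  qed
  then have "walk \<delta> N u \<one>\<^bsub>G\<^esub> = Some (fold \<delta> u \<one>\<^bsub>G\<^esub>)"
    using right_invertible_imp_walk[of N "{r}" u v "\<one>\<^bsub>G\<^esub>"] assms r N_closed N_one by blast
  then show ?thesis
    using walk_in[of \<delta> N u "\<one>\<^bsub>G\<^esub>"] fold_eq[OF assms(1), of "\<one>\<^bsub>G\<^esub>"] gcl_closed[OF assms(1), of "{r}"] by auto
qed

lemma concat_right_invertible:
  "set ps \<subseteq> prefixes_r \<Longrightarrow> \<exists>y\<in>carrier M. i (concat ps) \<otimes>\<^bsub>M\<^esub> y = \<one>\<^bsub>M\<^esub>"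
proof (induction ps)
  case Nil
  then show ?case by (intro bexI[of _ "\<one>\<^bsub>M\<^esub>"]) (simp_all flip: one_special_inv)
next
  case (Cons p ps)
  then obtain y where y: "y \<in> carrier M" "i (concat ps) \<otimes>\<^bsub>M\<^esub> y = \<one>\<^bsub>M\<^esub>" by auto
  obtain q where q: "r = p @ q" using Cons.prems by (auto simp: prefixes_r_def)
  have w: "p \<in> words A" "q \<in> words A" "concat ps \<in> words A" using q r Cons.prems concat_words by auto
  have pq: "i p \<otimes>\<^bsub>M\<^esub> i q = \<one>\<^bsub>M\<^esub>"
    using pcl_relator[of "{r}" A r "wagner A"] r q w by (simp add: one_special_inv flip: icl_append)
  have "i (concat (p # ps)) \<otimes>\<^bsub>M\<^esub> (y \<otimes>\<^bsub>M\<^esub> i q) = i p \<otimes>\<^bsub>M\<^esub> (i (concat ps) \<otimes>\<^bsub>M\<^esub> y) \<otimes>\<^bsub>M\<^esub> i q"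
    using w y(1) by (simp add: icl_append icl_closed M.m_assoc)
  then show ?case using pq y w by (intro bexI[of _ "y \<otimes>\<^bsub>M\<^esub> i q"]) (simp_all add: icl_closed)
qed

text \<open>An element with trivial image in \<open>G\<close> lies above an idempotent, so \<open>E\<close>-unitarity makes it
  idempotent, and the only right invertible idempotent is \<open>1\<close>.\<close>

lemma right_invertible_kernel:
  assumes u: "u \<in> words A" and gu: "g u = \<one>\<^bsub>G\<^esub>" and y: "y \<in> carrier M" "i u \<otimes>\<^bsub>M\<^esub> y = \<one>\<^bsub>M\<^esub>"
  shows "i u = \<one>\<^bsub>M\<^esub>"
proof -
  obtain m where m: "M.below m (i u)" "M.below m (i [])"
    using gcl_eq_imp_lower_bound[of "{r}" A u "[]"] r u gu by (auto simp: one_group_pres)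
  obtain e where e: "idempotent_elt M e" "m = e \<otimes>\<^bsub>M\<^esub> i u" using m(1) by (auto simp: M.below_def)
  have "idempotent_elt M m" using m(2) M.below_one_iff by (simp add: one_special_inv)
  then have "idempotent_elt M (i u)"
    using E_unitary e u unfolding E_unitary_def by (auto simp: icl_closed)
  then show ?thesis using y by (rule M.idem_right_invertible)
qed

text \<open>Write \<open>x\<close> and its inverse as products of prefixes. Both products are right invertible in \<open>M\<close>,
  and so are their products with each other, which are trivial in \<open>G\<close> and therefore in \<open>M\<close>.\<close>

lemma V_lift:
  assumes "x \<in> V" obtains u where "u \<in> words A" "g u = x" "i u \<in> Units M"
proof -
  obtain ps qs where ps: "set ps \<subseteq> prefixes_r" "x = g (concat ps)"
    and qs: "set qs \<subseteq> prefixes_r" "inv\<^bsub>G\<^esub> x = g (concat qs)"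
    using assms by (auto simp: V_def N_def)
  let ?u = "concat ps" and ?v = "concat qs"
  have w: "?u \<in> words A" "?v \<in> words A" using ps qs concat_words by auto
  have "i (?u @ ?v) = \<one>\<^bsub>M\<^esub>" "i (?v @ ?u) = \<one>\<^bsub>M\<^esub>"
  proof -
    have x: "x \<in> carrier G" using ps w by (simp add: gcl_closed)
    have "g (?u @ ?v) = \<one>\<^bsub>G\<^esub>" "g (?v @ ?u) = \<one>\<^bsub>G\<^esub>" using ps qs w x by (simp_all add: gcl_append flip: ps(2) qs(2))
    then show "i (?u @ ?v) = \<one>\<^bsub>M\<^esub>" "i (?v @ ?u) = \<one>\<^bsub>M\<^esub>"
      using right_invertible_kernel[of "?u @ ?v"] right_invertible_kernel[of "?v @ ?u"] w
        concat_right_invertible[of "ps @ qs"] concat_right_invertible[of "qs @ ps"] ps(1) qs(1)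
      unfolding concat_append by (metis Un_least set_append words_simps(2))+
  qed
  then have "i ?u \<in> Units M" using w by (auto simp: Units_def icl_append icl_closed intro!: bexI[of _ "i ?v"])
  then show ?thesis using that[of ?u] w ps by simp
qed

lemma V_subgroup: "subgroup V G"
proof (rule G.subgroupI)
  show "V \<noteq> {}" using N_one by (auto simp: V_def)
  fix x y assume "x \<in> V" "y \<in> V"
  then show "x \<otimes>\<^bsub>G\<^esub> y \<in> V" by (auto simp: V_def G.inv_mult_group N_closed intro!: N_mult)
qed (auto simp: V_def N_closed)

text \<open>If a product of elements of \<open>N\<close> has its inverse in \<open>N\<close>, then so does its first factor,
  because one-sided inverses in a submonoid of a group are two-sided. So only those prefixes that
  lie in \<open>V\<close> are needed to generate \<open>V\<close>.\<close>

lemma V_generated: "V = generate G (g ` {p \<in> prefixes_r. g p \<in> V})"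
proof
  have "set ps \<subseteq> prefixes_r \<Longrightarrow> g (concat ps) \<in> V \<Longrightarrow>
      g (concat ps) \<in> generate G (g ` {p \<in> prefixes_r. g p \<in> V})" for ps
  proof (induction ps)
    case Nil
    then show ?case using generate.one[of G] by (simp add: one_group_pres)
  next
    case (Cons p ps)
    let ?x = "g (concat (p # ps))" and ?y = "g (concat ps)"
    have w: "p \<in> words A" "concat ps \<in> words A" using Cons.prems prefixes_words concat_words by auto
    then have x: "?x = g p \<otimes>\<^bsub>G\<^esub> ?y" by (simp add: gcl_append)
    have c: "g p \<in> carrier G" "?y \<in> carrier G" using w by (auto simp: gcl_closed)
    have yN: "?y \<in> N" using Cons.prems by (auto simp: N_def)
    \<comment> \<open>The factor \<open>g p\<close> is right invertible in \<open>N\<close>, so its inverse in \<open>G\<close> lies in \<open>N\<close>.\<close>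
    have "inv\<^bsub>G\<^esub> (g p) = ?y \<otimes>\<^bsub>G\<^esub> inv\<^bsub>G\<^esub> ?x" using c x by (simp add: G.inv_mult_group flip: G.m_assoc)
    moreover have "\<dots> \<in> N" using yN Cons.prems(2) by (auto simp: V_def intro!: N_mult)
    ultimately have p: "g p \<in> V" using Cons.prems N_prefix by (auto simp: V_def)
    have "?y = inv\<^bsub>G\<^esub> (g p) \<otimes>\<^bsub>G\<^esub> ?x" using c x by (simp flip: G.m_assoc)
    then have "?y \<in> V" using p Cons.prems(2) V_subgroup by (simp add: subgroup.m_closed subgroup.m_inv_closed)
    then have "?y \<in> generate G (g ` {p \<in> prefixes_r. g p \<in> V})" using Cons by simp
    moreover have "g p \<in> generate G (g ` {p \<in> prefixes_r. g p \<in> V})"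
      using p Cons.prems by (auto intro: generate.incl)
    ultimately show ?case unfolding x by (rule generate.eng[rotated])
  qed
  then show "V \<subseteq> generate G (g ` {p \<in> prefixes_r. g p \<in> V})"
    by (auto simp: V_def N_def)
  show "generate G (g ` {p \<in> prefixes_r. g p \<in> V}) \<subseteq> V"
    by (rule G.generate_subgroup_incl[OF _ V_subgroup]) auto
qed

text \<open>The isomorphism is induced by the identity on words. It is injective on units because a unit
  with trivial image in \<open>G\<close> is \<open>1\<close>.\<close>

lemma units_iso: "units_of M \<cong> G\<lparr>carrier := V\<rparr>"
proof -
  define \<pi> where "\<pi> x = g (SOME u. u \<in> words A \<and> i u = x)" for x
  have \<pi>: "\<pi> (i u) = g u" if "u \<in> words A" for u
    unfolding \<pi>_def
  proof (rule someI2[of _ u])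
    fix v assume "v \<in> words A \<and> i v = i u"
    then show "g v = g u" using icl_eq_imp_gcl_eq[of "{r}" A v u] r that by simp
  qed (use that in simp)
  have rep: "\<exists>u\<in>words A. \<exists>v\<in>words A. x = i u \<and> i u \<otimes>\<^bsub>M\<^esub> i v = \<one>\<^bsub>M\<^esub> \<and> i v \<otimes>\<^bsub>M\<^esub> i u = \<one>\<^bsub>M\<^esub>"
    if "x \<in> Units M" for x
    using that by (auto simp: Units_def carrier_special_inv)
  have one: "g v = inv\<^bsub>G\<^esub> (g u)" if "u \<in> words A" "v \<in> words A" "i u \<otimes>\<^bsub>M\<^esub> i v = \<one>\<^bsub>M\<^esub>" for u v
  proof -
    have "g (u @ v) = g []"
      using icl_eq_imp_gcl_eq[of "{r}" A "u @ v" "[]"] r that by (simp add: icl_append one_special_inv)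
    then have "g u \<otimes>\<^bsub>G\<^esub> g v = \<one>\<^bsub>G\<^esub>" using that by (simp add: gcl_append one_group_pres)
    then show ?thesis using that G.inv_unique'[of "g u" "g v"] G.inv_comm[of "g u" "g v"] by (simp add: gcl_closed)
  qed
  have "inj_on \<pi> (Units M)"
  proof (rule inj_onI)
    fix x y assume "x \<in> Units M" "y \<in> Units M" and e: "\<pi> x = \<pi> y"
    then obtain u u' v v' where w: "u \<in> words A" "u' \<in> words A" "v \<in> words A" "v' \<in> words A"
      and x: "x = i u" "i u \<otimes>\<^bsub>M\<^esub> i u' = \<one>\<^bsub>M\<^esub>" and y: "y = i v" "i v \<otimes>\<^bsub>M\<^esub> i v' = \<one>\<^bsub>M\<^esub>" "i v' \<otimes>\<^bsub>M\<^esub> i v = \<one>\<^bsub>M\<^esub>"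
      using rep by meson
    have "g (u @ v') = \<one>\<^bsub>G\<^esub>"
      using e one[OF w(3,4) y(2)] w by (simp add: gcl_append \<pi> x(1) y(1) gcl_closed)
    moreover have "i (u @ v') \<otimes>\<^bsub>M\<^esub> (i v \<otimes>\<^bsub>M\<^esub> i u') = i u \<otimes>\<^bsub>M\<^esub> (i v' \<otimes>\<^bsub>M\<^esub> i v) \<otimes>\<^bsub>M\<^esub> i u'"
      using w by (simp add: icl_append icl_closed M.m_assoc)
    ultimately have "i (u @ v') = \<one>\<^bsub>M\<^esub>"
      using right_invertible_kernel[of "u @ v'" "i v \<otimes>\<^bsub>M\<^esub> i u'"] w x y by (simp add: icl_closed)
    then have "i u \<otimes>\<^bsub>M\<^esub> i v' \<otimes>\<^bsub>M\<^esub> i v = i v" using w by (simp add: icl_append icl_closed)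
    then show "x = y" using w x y by (simp add: icl_closed M.m_assoc)
  qed
  moreover have "\<pi> ` Units M = V"
  proof
    show "\<pi> ` Units M \<subseteq> V"
    proof clarify
      fix x assume "x \<in> Units M"
      then obtain u v where "u \<in> words A" "v \<in> words A" "x = i u" "i u \<otimes>\<^bsub>M\<^esub> i v = \<one>\<^bsub>M\<^esub>" "i v \<otimes>\<^bsub>M\<^esub> i u = \<one>\<^bsub>M\<^esub>"
        using rep by meson
      then show "\<pi> x \<in> V"
        using right_invertible_in_N[of u v] right_invertible_in_N[of v u] one[of u v] by (simp add: V_def \<pi>)
    qed
    show "V \<subseteq> \<pi> ` Units M"
    proof
      fix x assume "x \<in> V"
      then obtain u where "u \<in> words A" "g u = x" "i u \<in> Units M" by (rule V_lift)
      then show "x \<in> \<pi> ` Units M" using \<pi> by force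
    qed
  qed
  moreover have "\<pi> (x \<otimes>\<^bsub>M\<^esub> y) = \<pi> x \<otimes>\<^bsub>G\<^esub> \<pi> y" if xy: "x \<in> Units M" "y \<in> Units M" for x y
  proof -
    obtain u v where "u \<in> words A" "v \<in> words A" "x = i u" "y = i v" using rep[OF xy(1)] rep[OF xy(2)] by auto
    then show ?thesis using \<pi>[of "u @ v"] by (simp add: \<pi> icl_append gcl_append)
  qed
  ultimately have "\<pi> \<in> iso (units_of M) (G\<lparr>carrier := V\<rparr>)"
    by (auto simp: iso_def hom_def bij_betw_def units_of_def)
  then show ?thesis by (auto simp: is_iso_def)
qed

lemma finitely_presented_units:
  assumes coh: "\<forall>(A :: 'a set) r. r \<in> words A \<longrightarrow>
      finitely_presented (group_pres A {r}) \<longrightarrow> coherent (group_pres A {r})"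
  shows "finitely_presented (units_of M)"
proof -
  have "finitely_presented (G\<lparr>carrier := generate G (g ` {p \<in> prefixes_r. g p \<in> V})\<rparr>)"
    by (rule finitely_presented_generate[OF coh r]) (auto simp: finite_prefixes prefixes_words)
  then have "finitely_presented (G\<lparr>carrier := V\<rparr>)"
    using V_generated by simp
  then show ?thesis by (rule finitely_presented_iso[OF M.units_group units_iso])
qed

end

section \<open>Realising finitely generated subgroups in groups of units\<close>

text \<open>The word \<open>p\<^sub>1 p\<^sub>1\<inverse> \<dots> p\<^sub>k p\<^sub>k\<inverse> r p\<^sub>k\<inverse> p\<^sub>k \<dots> p\<^sub>1\<inverse> p\<^sub>1\<close>. In an inverse monoid,
  making it trivial amounts to making \<open>r\<close> trivial and all \<open>p\<^sub>i\<close> invertible, so one relator does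
  the work of many.\<close>

fun pad :: "'a word list \<Rightarrow> 'a word \<Rightarrow> 'a word" where
  "pad [] r = r"
| "pad (p # ps) r = p @ winv p @ pad ps r @ winv p @ p"

lemma pad_words: "set ps \<subseteq> words A \<Longrightarrow> r \<in> words A \<Longrightarrow> pad ps r \<in> words A"
  by (induction ps) auto

text \<open>A right or left invertible idempotent is \<open>1\<close>, so the outermost factors \<open>p p\<inverse>\<close> and \<open>p\<inverse> p\<close>
  of a trivial padded word can be stripped off one piece at a time.\<close>

lemma icl_pad_trivial:
  assumes R: "R \<subseteq> words A" and r: "r \<in> words A"
  shows "set ps \<subseteq> words A \<Longrightarrow> icl A R (pad ps r) = icl A R [] \<Longrightarrow>
    icl A R r = icl A R [] \<and> (\<forall>p\<in>set ps. icl A R (p @ winv p) = icl A R [] \<and> icl A R (winv p @ p) = icl A R [])"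
proof (induction ps)
  case (Cons p ps)
  let ?M = "special_inv A R"
  interpret M: inverse_monoid ?M by (rule inverse_monoid_special_inv[OF R])
  have p: "p \<in> words A" and q: "pad ps r \<in> words A" using Cons.prems r by (auto simp: pad_words)
  have idem: "idempotent_elt ?M (icl A R (w @ winv w))" if "w \<in> words A" for w
    unfolding icl_append[OF that winv_in_words[THEN iffD2, OF that]]
    by (rule M.idem_inverse_pair)
      (use that icl_inverse_pair[OF R that] in \<open>auto simp: icl_closed simp flip: icl_append\<close>)
  have e: "icl A R (p @ winv p) = \<one>\<^bsub>?M\<^esub>"
  proof (rule M.idem_right_invertible[OF idem[OF p]])
    show "icl A R (p @ winv p) \<otimes>\<^bsub>?M\<^esub> icl A R (pad ps r @ winv p @ p) = \<one>\<^bsub>?M\<^esub>"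
      using Cons.prems(2) p q by (simp add: one_special_inv flip: icl_append)
  qed (use p q in \<open>simp add: icl_closed\<close>)
  have f: "icl A R (winv p @ p) = \<one>\<^bsub>?M\<^esub>"
  proof (rule M.idem_left_invertible)
    show "idempotent_elt ?M (icl A R (winv p @ p))" using idem[of "winv p"] p by simp
    show "icl A R (p @ winv p @ pad ps r) \<otimes>\<^bsub>?M\<^esub> icl A R (winv p @ p) = \<one>\<^bsub>?M\<^esub>"
      using Cons.prems(2) p q by (simp add: one_special_inv flip: icl_append)
  qed (use p q in \<open>simp add: icl_closed\<close>)
  have "icl A R (pad (p # ps) r) = icl A R (p @ winv p) \<otimes>\<^bsub>?M\<^esub> icl A R (pad ps r) \<otimes>\<^bsub>?M\<^esub> icl A R (winv p @ p)"
    using p q by (simp flip: icl_append)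
  also have "\<dots> = icl A R (pad ps r)" using e f q by (simp add: icl_closed)
  finally have "icl A R (pad ps r) = icl A R []" using Cons.prems(2) by simp
  then show ?case using Cons e f by (auto simp: one_special_inv)
qed simp

lemma (in letter_action) walk_pad:
  assumes N: "N \<subseteq> \<Omega>" and r: "walk \<delta> N r n = Some n"
  shows "set ps \<subseteq> words A \<Longrightarrow>
    (\<And>p. p \<in> set ps \<Longrightarrow> walk \<delta> N p n \<noteq> None \<and> walk \<delta> N (winv p) n \<noteq> None) \<Longrightarrow>
    walk \<delta> N (pad ps r) n = Some n"
proof (induction ps)
  case (Cons p ps)
  obtain m k where m: "walk \<delta> N p n = Some m" and k: "walk \<delta> N (winv p) n = Some k"
    using Cons.prems(2)[of p] by auto
  have "walk \<delta> N (winv p) m = Some n" "walk \<delta> N p k = Some n"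
    using walk_winv[OF N, of p] m k Cons.prems(1) by auto
  then show ?case using m k Cons by (simp add: walk_append)
qed (simp add: r)

text \<open>The group \<open>G\<close> presented by \<open>xs\<close> and \<open>r\<close> contains the subgroup \<open>H\<close> generated by the words
  \<open>ws\<close>. The inverse monoid \<open>M\<close> has one further letter \<open>t\<close>, and its relator says that the letters
  of \<open>xs\<close> and all words \<open>t w t\<inverse>\<close> are invertible and \<open>r\<close> is trivial. The empty word in \<open>ws\<close> makes
  \<open>t\<close> right invertible.\<close>

locale unit_coding =
  fixes xs :: "'a list" and r :: "'a word" and ws :: "'a word list" and t :: 'a
  assumes r: "r \<in> words (set xs)" and ws: "set ws \<subseteq> words (set xs)" and Nil_ws: "[] \<in> set ws"
    and t: "t \<notin> set xs"
begin

definition conj_t :: "'a word \<Rightarrow> 'a word" where "conj_t w = (t, True) # w @ [(t, False)]"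

definition pieces :: "'a word list" where
  "pieces = map (\<lambda>x. [(x, True)]) xs @ map conj_t ws"

definition relator :: "'a word" where "relator = pad pieces r"

definition B where "B = insert t (set xs)"

abbreviation "G \<equiv> group_pres (set xs) {r}"
abbreviation "g \<equiv> gcl (set xs) {r}"
abbreviation "M \<equiv> special_inv B {relator}"
abbreviation "i \<equiv> icl B {relator}"
abbreviation "H \<equiv> generate G (g ` set ws)"

lemma words_B: "u \<in> words (set xs) \<Longrightarrow> u \<in> words B"
  by (auto simp: words_iff B_def)

lemma xs_B: "a \<in> set xs \<Longrightarrow> a \<in> B" by (simp add: B_def)

lemma t_B: "t \<in> B" by (simp add: B_def)

lemma conj_t_words: "conj_t w \<in> words B \<longleftrightarrow> w \<in> words B"
  by (simp add: conj_t_def t_B)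

lemma winv_conj_t: "winv (conj_t w) = conj_t (winv w)"
  by (simp add: conj_t_def)

lemma pieces_words: "set pieces \<subseteq> words B"
  using ws words_B by (auto simp: pieces_def conj_t_words xs_B)

lemma relator_words: "relator \<in> words B"
  unfolding relator_def by (rule pad_words[OF pieces_words words_B[OF r]])

sublocale G: group G by (rule group_group_pres) (use r in simp)
sublocale M: inverse_monoid M by (rule inverse_monoid_special_inv) (use relator_words in simp)

lemma g_r: "g r = \<one>\<^bsub>G\<^esub>"
  using pcl_relator[of "{r}" "set xs" r "free_reduction (set xs)"] r by (simp add: one_group_pres)

lemma H_carrier: "H \<subseteq> carrier G"
  by (rule G.generate_incl) (use ws gcl_closed in blast)

lemma H_subgroup: "subgroup H G"
  by (rule G.generate_is_subgroup) (use ws gcl_closed in blast)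

lemma g_ws_H: "w \<in> set ws \<Longrightarrow> g w \<in> H"
  by (auto intro: generate.incl)

lemma relations:
  shows i_r: "i r = \<one>\<^bsub>M\<^esub>"
    and i_piece: "p \<in> set pieces \<Longrightarrow> i (p @ winv p) = \<one>\<^bsub>M\<^esub> \<and> i (winv p @ p) = \<one>\<^bsub>M\<^esub>"
  using icl_pad_trivial[of "{relator}" B r pieces] pieces_words relator_words words_B[OF r]
    pcl_relator[of "{relator}" B relator "wagner B"]
  by (simp_all add: one_special_inv flip: relator_def)

lemma i_winv: "u \<in> words (set xs) \<Longrightarrow> i (u @ winv u) = \<one>\<^bsub>M\<^esub>"
proof (induction u)
  case Nil
  then show ?case by (simp add: one_special_inv)
next
  case (Cons l u)
  obtain a b where l: "l = (a, b)" "a \<in> set xs" using Cons.prems by (cases l) auto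
  have u: "u \<in> words B" using Cons.prems words_B by simp
  have a: "a \<in> B" using l by (simp add: B_def)
  have "[(a, True)] \<in> set pieces" using l by (auto simp: pieces_def)
  then have ab: "i [(a, b), (a, \<not> b)] = \<one>\<^bsub>M\<^esub>" using i_piece[of "[(a, True)]"] by (cases b) auto
  have "i ((l # u) @ winv (l # u)) = i ([l] @ (u @ winv u) @ [(a, \<not> b)])" by (simp add: l)
  also have "\<dots> = i [l] \<otimes>\<^bsub>M\<^esub> i [(a, \<not> b)]"
    using Cons.IH Cons.prems u l a icl_append[of "[l]" B "(u @ winv u) @ [(a, \<not> b)]"]
      icl_append[of "u @ winv u" B "[(a, \<not> b)]"]
    by (simp add: icl_closed)
  also have "\<dots> = i ([l] @ [(a, \<not> b)])" using l a by (subst icl_append) auto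
  finally show ?case using ab l by simp
qed

text \<open>As the letters of \<open>xs\<close> are invertible, \<open>G\<close> maps into the units of \<open>M\<close>.\<close>

definition \<theta> where "\<theta> h = i (SOME u. u \<in> words (set xs) \<and> g u = h)"

lemma g_eq_imp_i_eq:
  assumes "u \<in> words (set xs)" "v \<in> words (set xs)" "g u = g v" shows "i u = i v"
proof -
  have "(u, v) \<in> gen_cong (word_monoid (set xs)) (rels (free_reduction (set xs)) {r})"
    using assms r by (simp add: pcl_eq_iff)
  then show ?thesis
  proof induction
    case (base x y)
    then show ?case using i_r i_winv by (auto simp: free_reduction_def one_special_inv)
  next
    case (mult x y x' y')
    then show ?case
      using gen_cong_words[OF mult.hyps(1)] gen_cong_words[OF mult.hyps(2)] by (simp add: icl_append words_B)
  qed simp_all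
qed

lemma \<theta>_g: "u \<in> words (set xs) \<Longrightarrow> \<theta> (g u) = i u"
  unfolding \<theta>_def
proof (rule someI2[of _ u])
  fix v assume "u \<in> words (set xs)" "v \<in> words (set xs) \<and> g v = g u"
  then show "i v = i u" using g_eq_imp_i_eq[of v u] by simp
qed simp

lemma \<theta>_closed: "h \<in> carrier G \<Longrightarrow> \<theta> h \<in> carrier M"
  by (auto simp: carrier_group_pres \<theta>_g intro!: icl_closed words_B)

lemma \<theta>_mult: "h \<in> carrier G \<Longrightarrow> h' \<in> carrier G \<Longrightarrow> \<theta> (h \<otimes>\<^bsub>G\<^esub> h') = \<theta> h \<otimes>\<^bsub>M\<^esub> \<theta> h'"
  by (auto simp: carrier_group_pres \<theta>_g words_B icl_append simp flip: gcl_append)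

lemma \<theta>_one: "\<theta> \<one>\<^bsub>G\<^esub> = \<one>\<^bsub>M\<^esub>"
  by (simp add: one_group_pres \<theta>_g one_special_inv)

lemma \<theta>_inv: "h \<in> carrier G \<Longrightarrow> \<theta> (inv\<^bsub>G\<^esub> h) \<otimes>\<^bsub>M\<^esub> \<theta> h = \<one>\<^bsub>M\<^esub> \<and> \<theta> h \<otimes>\<^bsub>M\<^esub> \<theta> (inv\<^bsub>G\<^esub> h) = \<one>\<^bsub>M\<^esub>"
  by (simp add: \<theta>_one flip: \<theta>_mult)

abbreviation "T b \<equiv> i [(t, b)]"
abbreviation "F \<equiv> T False \<otimes>\<^bsub>M\<^esub> T True"

lemma T_closed: "T b \<in> carrier M"
  by (simp add: icl_closed t_B)

text \<open>The piece \<open>t t\<inverse>\<close> is invertible and idempotent.\<close>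

lemma T_right_inverse: "T True \<otimes>\<^bsub>M\<^esub> T False = \<one>\<^bsub>M\<^esub>"
proof -
  have "conj_t [] \<in> set pieces" using Nil_ws by (simp add: pieces_def)
  from i_piece[OF this] have p: "i (conj_t [] @ conj_t []) = \<one>\<^bsub>M\<^esub>" by (simp add: winv_conj_t)
  have "idempotent_elt M (i (conj_t []))"
    using icl_inverse_pair[of "{relator}" B "[(t, True)]"] relator_words
      M.idem_inverse_pair[of "T True" "T False"]
    by (simp add: conj_t_def T_closed t_B icl_append[of "[_]" B "[_]", simplified]
        icl_append[of "[_]" B "[_, _]", simplified] icl_closed M.m_assoc)
  then have "i (conj_t []) = \<one>\<^bsub>M\<^esub>"
    by (rule M.idem_right_invertible[of _ "i (conj_t [])"])
      (use p in \<open>simp_all add: icl_closed conj_t_words icl_append\<close>)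
  then show ?thesis using icl_append[of "[(t, True)]" B "[(t, False)]"] by (simp add: conj_t_def t_B)
qed

lemma T_idem: "idempotent_elt M (T (\<not> b) \<otimes>\<^bsub>M\<^esub> T b)"
proof (cases b)
  case True
  have "F \<otimes>\<^bsub>M\<^esub> F = T False \<otimes>\<^bsub>M\<^esub> (T True \<otimes>\<^bsub>M\<^esub> T False) \<otimes>\<^bsub>M\<^esub> T True"
    by (simp only: M.m_assoc M.m_closed T_closed)
  then show ?thesis using True by (simp add: T_right_inverse idempotent_elt_def T_closed)
next
  case False
  then show ?thesis by (simp add: T_right_inverse M.idem_one)
qed

subsection \<open>Normal forms and \<open>E\<close>-unitarity\<close>

text \<open>The pair \<open>([(b\<^sub>k, h\<^sub>k), \<dots>, (b\<^sub>1, h\<^sub>1)], h)\<close> stands for the normal form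
  \<open>h\<^sub>1 t\<^bsup>b\<^sub>1\<^esup> \<dots> h\<^sub>k t\<^bsup>b\<^sub>k\<^esup> h\<close> in the free product of \<open>G\<close> and the infinite cyclic group on \<open>t\<close>.
  Words act on normal forms by multiplication on the right.\<close>

definition push where
  "push b l h = (if l \<noteq> [] \<and> h = \<one>\<^bsub>G\<^esub> \<and> fst (hd l) = (\<not> b) then (tl l, snd (hd l))
     else ((b, h) # l, \<one>\<^bsub>G\<^esub>))"

definition nf_act where
  "nf_act = (\<lambda>(a, b) (l, h). if a = t then push b l h else (l, h \<otimes>\<^bsub>G\<^esub> g [(a, b)]))"

fun reduced where
  "reduced [] \<longleftrightarrow> True"
| "reduced ((b, h) # l) \<longleftrightarrow> h \<in> carrier G \<and> \<not> (l \<noteq> [] \<and> h = \<one>\<^bsub>G\<^esub> \<and> fst (hd l) = (\<not> b)) \<and> reduced l"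

definition normal_forms where "normal_forms = {(l, h). reduced l \<and> h \<in> carrier G}"

sublocale nf: letter_action B nf_act normal_forms
proof
  fix a b n assume a: "a \<in> B" and n: "n \<in> normal_forms"
  obtain l h where lh: "n = (l, h)" "reduced l" "h \<in> carrier G"
    using n by (auto simp: normal_forms_def)
  have g: "g [(a, c)] \<in> carrier G" if "a \<noteq> t" for c using a that by (simp add: gcl_closed B_def)
  have "push b l h \<in> normal_forms"
    using lh by (cases l rule: reduced.cases) (simp_all add: push_def normal_forms_def)
  then show "nf_act (a, b) n \<in> normal_forms"
    using lh g by (simp add: nf_act_def normal_forms_def)
  show "nf_act (a, \<not> b) (nf_act (a, b) n) = n"
  proof (cases "a = t")
    case True
    have "case_prod (push (\<not> b)) (push b l h) = (l, h)"
    proof (cases "l \<noteq> [] \<and> h = \<one>\<^bsub>G\<^esub> \<and> fst (hd l) = (\<not> b)")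
      case True
      then obtain h' l' where l: "l = (\<not> b, h') # l'" by (cases l) auto
      have "push b l h = (l', h')" using True by (simp add: push_def l)
      moreover have "push (\<not> b) l' h' = ((\<not> b, h') # l', \<one>\<^bsub>G\<^esub>)"
        unfolding push_def by (rule if_not_P) (use lh(2) l in simp)
      ultimately show ?thesis using True l by simp
    next
      case False
      then have "push b l h = ((b, h) # l, \<one>\<^bsub>G\<^esub>)" unfolding push_def by (rule if_not_P)
      then show ?thesis by (simp add: push_def)
    qed
    then show ?thesis using True lh by (simp add: nf_act_def split_def)
  next
    case False
    then have ax: "a \<in> set xs" using a by (simp add: B_def)
    have "g [(a, \<not> b)] = inv\<^bsub>G\<^esub> g [(a, b)]"
      using inv_gcl[of "{r}" "set xs" "[(a, b)]"] ax r by simp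
    then show ?thesis using False ax lh by (simp add: nf_act_def gcl_closed G.m_assoc)
  qed
qed

lemma nf_act_word:
  "u \<in> words (set xs) \<Longrightarrow> h \<in> carrier G \<Longrightarrow> fold nf_act u (l, h) = (l, h \<otimes>\<^bsub>G\<^esub> g u)"
proof (induction u arbitrary: h)
  case Nil
  then show ?case by (simp flip: one_group_pres)
next
  case (Cons c u)
  then show ?case using t
    by (cases c) (auto simp: nf_act_def gcl_closed gcl_Cons[of _ "set xs" u] G.m_assoc)
qed

fun nf_val where
  "nf_val [] h = \<theta> h"
| "nf_val ((b, h') # l) h = nf_val l h' \<otimes>\<^bsub>M\<^esub> T b \<otimes>\<^bsub>M\<^esub> \<theta> h"

lemma nf_val_closed: "reduced l \<Longrightarrow> h \<in> carrier G \<Longrightarrow> nf_val l h \<in> carrier M"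
  by (induction l h rule: nf_val.induct) (auto simp: \<theta>_closed T_closed)

lemma nf_val_mult:
  "reduced l \<Longrightarrow> h \<in> carrier G \<Longrightarrow> h' \<in> carrier G \<Longrightarrow> nf_val l h \<otimes>\<^bsub>M\<^esub> \<theta> h' = nf_val l (h \<otimes>\<^bsub>G\<^esub> h')"
  by (cases "(l, h)" rule: nf_val.cases) (auto simp: \<theta>_mult \<theta>_closed T_closed nf_val_closed M.m_assoc)

text \<open>Rewriting a word to its normal form multiplies exactly within \<open>G\<close>, and cancelling
  \<open>t\<inverse> t\<close> moves upwards in the natural order. So every element lies below its normal form.\<close>

lemma below_nf_val:
  assumes "u \<in> words B"
  shows "M.below (i u) (case_prod nf_val (fold nf_act u ([], \<one>\<^bsub>G\<^esub>)))"
  using assms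
proof (induction u rule: rev_induct)
  case Nil
  then show ?case using M.below_refl[OF M.one_closed] by (simp add: \<theta>_one one_special_inv)
next
  case (snoc c u)
  obtain a b where c: "c = (a, b)" "a \<in> B" using snoc.prems by (cases c) auto
  have u: "u \<in> words B" using snoc.prems by simp
  have s: "fold nf_act u ([], \<one>\<^bsub>G\<^esub>) \<in> normal_forms"
    by (rule nf.fold_closed[OF u]) (simp add: normal_forms_def)
  obtain l h where lh: "fold nf_act u ([], \<one>\<^bsub>G\<^esub>) = (l, h)" by fastforce
  have red: "reduced l" "h \<in> carrier G" using s lh by (auto simp: normal_forms_def)
  have "M.below (i u \<otimes>\<^bsub>M\<^esub> i [c]) (nf_val l h \<otimes>\<^bsub>M\<^esub> i [c])"
    using snoc.IH[OF u] lh c by (intro M.below_mult M.below_refl) (auto simp: icl_closed)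
  moreover have "M.below (nf_val l h \<otimes>\<^bsub>M\<^esub> i [c]) (case_prod nf_val (nf_act c (l, h)))"
  proof (cases "a = t")
    case False
    then have a: "a \<in> set xs" using c by (simp add: B_def)
    then have "nf_val l h \<otimes>\<^bsub>M\<^esub> i [c] = nf_val l (h \<otimes>\<^bsub>G\<^esub> g [c])"
      using nf_val_mult[OF red, of "g [c]"] c by (simp add: gcl_closed \<theta>_g)
    then show ?thesis using False c red a
      by (auto simp: nf_act_def gcl_closed intro!: M.below_refl nf_val_closed)
  next
    case True
    show ?thesis
    proof (cases "l \<noteq> [] \<and> h = \<one>\<^bsub>G\<^esub> \<and> fst (hd l) = (\<not> b)")
      case cancel: True
      then obtain h' l' where l: "l = (\<not> b, h') # l'" by (cases l) auto
      have cl: "nf_val l' h' \<in> carrier M" using red l by (auto intro: nf_val_closed)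
      have "nf_val l h \<otimes>\<^bsub>M\<^esub> i [c] = nf_val l' h' \<otimes>\<^bsub>M\<^esub> (T (\<not> b) \<otimes>\<^bsub>M\<^esub> T b)"
        using cancel cl True c by (simp add: l \<theta>_one T_closed M.m_assoc)
      moreover have "M.below (nf_val l' h' \<otimes>\<^bsub>M\<^esub> (T (\<not> b) \<otimes>\<^bsub>M\<^esub> T b)) (nf_val l' h' \<otimes>\<^bsub>M\<^esub> \<one>\<^bsub>M\<^esub>)"
        by (intro M.below_mult M.below_refl cl) (simp only: M.below_one_iff T_idem)
      ultimately show ?thesis using cancel True c cl by (simp add: nf_act_def push_def l)
    next
      case False
      then have "nf_act c (l, h) = ((b, h) # l, \<one>\<^bsub>G\<^esub>)" using True c by (auto simp: nf_act_def push_def)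
      then show ?thesis using True c nf_val_closed[OF red]
        by (auto simp: \<theta>_one T_closed intro!: M.below_refl)
    qed
  qed
  ultimately show ?case using M.below_trans u c lh by (simp add: icl_append)
qed

lemma nf_relator: "n \<in> normal_forms \<Longrightarrow> walk nf_act normal_forms relator n = Some n"
  unfolding relator_def
proof (rule nf.walk_pad[OF order.refl])
  assume n: "n \<in> normal_forms"
  show "walk nf_act normal_forms r n = Some n"
    using nf.walk_total[OF words_B[OF r] n] n nf_act_word[OF r] g_r by (auto simp: normal_forms_def)
  show "set pieces \<subseteq> words B" by (rule pieces_words)
  fix p assume "p \<in> set pieces"
  then have "p \<in> words B" using pieces_words by blast
  then show "walk nf_act normal_forms p n \<noteq> None \<and> walk nf_act normal_forms (winv p) n \<noteq> None"
    using nf.walk_total n by simp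
qed

lemma nf_act_well_defined:
  assumes "u \<in> words B" "v \<in> words B" "i u = i v" "n \<in> normal_forms"
  shows "fold nf_act u n = fold nf_act v n"
  using nf.icl_eq_imp_walk_eq[of normal_forms "{relator}" u v n] nf_relator relator_words assms
    nf.walk_total[of u n] nf.walk_total[of v n] by simp

text \<open>Words act by permutations, and an idempotent permutation is the identity.\<close>

lemma nf_act_idem:
  assumes u: "u \<in> words B" "idempotent_elt M (i u)" and n: "n \<in> normal_forms"
  shows "fold nf_act u n = n"
proof -
  have "i (u @ u) = i u" using u by (simp add: icl_append idempotent_elt_def)
  then have "fold nf_act u (fold nf_act u n) = fold nf_act u n"
    using nf_act_well_defined[of "u @ u" u n] u n by simp
  moreover have "walk nf_act normal_forms (winv u) (fold nf_act u m) = Some m" if "m \<in> normal_forms" for m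
    using nf.walk_winv[OF order.refl u(1)] nf.walk_total[OF u(1) that] by blast
  ultimately show ?thesis using n nf.fold_closed[OF u(1) n] by (metis option.inject)
qed

text \<open>If \<open>e\<close> and \<open>e s\<close> are idempotent, then both act trivially on normal forms, hence so does \<open>s\<close>.
  Its normal form is therefore trivial, which puts \<open>s\<close> below \<open>1\<close>.\<close>

lemma E_unitary_M: "E_unitary M"
  unfolding E_unitary_def
proof (intro allI impI)
  fix e s assume s: "s \<in> carrier M" and e: "idempotent_elt M e" and es: "idempotent_elt M (e \<otimes>\<^bsub>M\<^esub> s)"
  obtain u v where u: "u \<in> words B" "e = i u" and v: "v \<in> words B" "s = i v"
    using s M.idem_closed[OF e] by (auto simp: carrier_special_inv)
  have n: "([], \<one>\<^bsub>G\<^esub>) \<in> normal_forms" by (simp add: normal_forms_def)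
  have "fold nf_act (u @ v) ([], \<one>\<^bsub>G\<^esub>) = ([], \<one>\<^bsub>G\<^esub>)"
    using nf_act_idem[of "u @ v"] u v es n by (simp add: icl_append)
  moreover have "fold nf_act u ([], \<one>\<^bsub>G\<^esub>) = ([], \<one>\<^bsub>G\<^esub>)"
    using nf_act_idem[of u] u e n by simp
  ultimately have "fold nf_act v ([], \<one>\<^bsub>G\<^esub>) = ([], \<one>\<^bsub>G\<^esub>)" by simp
  then have "M.below s \<one>\<^bsub>M\<^esub>" using below_nf_val[OF v(1)] v by (simp add: \<theta>_one)
  then show "idempotent_elt M s" by (simp add: M.below_one_iff)
qed

subsection \<open>\<open>H\<close> embeds in the units of \<open>M\<close>\<close>

text \<open>Invertibility of \<open>t w t\<inverse>\<close> and of its inverse gives \<open>F \<le> w F w\<inverse>\<close> and \<open>F \<le> w\<inverse> F w\<close> for the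
  idempotent \<open>F = t\<inverse> t\<close>, so \<open>w\<close> commutes with \<open>F\<close>.\<close>

lemma F_commutes_ws:
  assumes w: "w \<in> set ws" shows "\<theta> (g w) \<otimes>\<^bsub>M\<^esub> F = F \<otimes>\<^bsub>M\<^esub> \<theta> (g w)"
proof -
  have wx: "w \<in> words (set xs)" using w ws by auto
  let ?W = "i w" and ?W' = "i (winv w)"
  have c: "?W \<in> carrier M" "?W' \<in> carrier M" using wx by (auto intro!: icl_closed words_B)
  have WW: "?W \<otimes>\<^bsub>M\<^esub> ?W' = \<one>\<^bsub>M\<^esub>" "?W' \<otimes>\<^bsub>M\<^esub> ?W = \<one>\<^bsub>M\<^esub>"
    using i_winv[OF wx] i_winv[of "winv w"] wx words_B by (simp_all add: icl_append)
  have conj: "i (conj_t v) = T True \<otimes>\<^bsub>M\<^esub> i v \<otimes>\<^bsub>M\<^esub> T False" if "v \<in> words (set xs)" for v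
    using that icl_append[of "[(t, True)]" B "v @ [(t, False)]"] icl_append[of v B "[(t, False)]"]
    by (simp add: conj_t_def t_B words_B icl_closed M.m_assoc)
  have "conj_t w \<in> set pieces" using w by (simp add: pieces_def)
  note p = i_piece[OF this]
  have F: "F \<in> carrier M" "idempotent_elt M F" using T_idem[of True] by (simp_all add: T_closed)
  have key: "F \<otimes>\<^bsub>M\<^esub> (y \<otimes>\<^bsub>M\<^esub> F \<otimes>\<^bsub>M\<^esub> z) = F"
    if y: "y \<in> carrier M" and z: "z \<in> carrier M" and zy: "z \<otimes>\<^bsub>M\<^esub> y = \<one>\<^bsub>M\<^esub>"
      and e: "(T True \<otimes>\<^bsub>M\<^esub> y \<otimes>\<^bsub>M\<^esub> T False) \<otimes>\<^bsub>M\<^esub> (T True \<otimes>\<^bsub>M\<^esub> z \<otimes>\<^bsub>M\<^esub> T False) = \<one>\<^bsub>M\<^esub>" for y z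
  proof -
    have "y \<otimes>\<^bsub>M\<^esub> F \<otimes>\<^bsub>M\<^esub> z \<otimes>\<^bsub>M\<^esub> (y \<otimes>\<^bsub>M\<^esub> F \<otimes>\<^bsub>M\<^esub> z) = y \<otimes>\<^bsub>M\<^esub> (F \<otimes>\<^bsub>M\<^esub> (z \<otimes>\<^bsub>M\<^esub> y) \<otimes>\<^bsub>M\<^esub> F) \<otimes>\<^bsub>M\<^esub> z"
      using y z F(1) by (simp only: M.m_assoc M.m_closed)
    then have E: "idempotent_elt M (y \<otimes>\<^bsub>M\<^esub> F \<otimes>\<^bsub>M\<^esub> z)"
      using zy y z F by (simp add: idempotent_elt_def)
    have "F = T False \<otimes>\<^bsub>M\<^esub> ((T True \<otimes>\<^bsub>M\<^esub> y \<otimes>\<^bsub>M\<^esub> T False) \<otimes>\<^bsub>M\<^esub> (T True \<otimes>\<^bsub>M\<^esub> z \<otimes>\<^bsub>M\<^esub> T False)) \<otimes>\<^bsub>M\<^esub> T True"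
      by (simp add: e T_closed)
    also have "\<dots> = F \<otimes>\<^bsub>M\<^esub> (y \<otimes>\<^bsub>M\<^esub> F \<otimes>\<^bsub>M\<^esub> z) \<otimes>\<^bsub>M\<^esub> F"
      using y z by (simp only: M.m_assoc M.m_closed T_closed)
    also have "\<dots> = F \<otimes>\<^bsub>M\<^esub> ((y \<otimes>\<^bsub>M\<^esub> F \<otimes>\<^bsub>M\<^esub> z) \<otimes>\<^bsub>M\<^esub> F)"
      using y z F(1) by (intro M.m_assoc M.m_closed T_closed)
    also have "\<dots> = F \<otimes>\<^bsub>M\<^esub> (F \<otimes>\<^bsub>M\<^esub> (y \<otimes>\<^bsub>M\<^esub> F \<otimes>\<^bsub>M\<^esub> z))"
      by (simp only: M.idem_comm[OF E F(2)])
    also have "\<dots> = F \<otimes>\<^bsub>M\<^esub> F \<otimes>\<^bsub>M\<^esub> (y \<otimes>\<^bsub>M\<^esub> F \<otimes>\<^bsub>M\<^esub> z)"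
      using y z F(1) by (simp only: M.m_assoc M.m_closed)
    finally show ?thesis using F(2) by (simp add: idempotent_elt_def)
  qed
  let ?E = "?W \<otimes>\<^bsub>M\<^esub> F \<otimes>\<^bsub>M\<^esub> ?W'"
  have cw: "conj_t w \<in> words B" "conj_t (winv w) \<in> words B" using wx by (simp_all add: conj_t_words words_B)
  have FE: "F \<otimes>\<^bsub>M\<^esub> ?E = F"
    by (rule key[OF c WW(2)]) (use p wx cw in \<open>simp add: winv_conj_t conj icl_append\<close>)
  have FE': "F \<otimes>\<^bsub>M\<^esub> (?W' \<otimes>\<^bsub>M\<^esub> F \<otimes>\<^bsub>M\<^esub> ?W) = F"
    by (rule key[OF c(2,1) WW(1)]) (use p wx cw in \<open>simp add: winv_conj_t conj icl_append\<close>)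
  have "?E \<otimes>\<^bsub>M\<^esub> ?E = ?W \<otimes>\<^bsub>M\<^esub> (F \<otimes>\<^bsub>M\<^esub> (?W' \<otimes>\<^bsub>M\<^esub> ?W) \<otimes>\<^bsub>M\<^esub> F) \<otimes>\<^bsub>M\<^esub> ?W'"
    using c F(1) by (simp only: M.m_assoc M.m_closed)
  then have Ei: "idempotent_elt M ?E" using WW c F by (simp add: idempotent_elt_def)
  have "?E = ?W \<otimes>\<^bsub>M\<^esub> (F \<otimes>\<^bsub>M\<^esub> (?W' \<otimes>\<^bsub>M\<^esub> F \<otimes>\<^bsub>M\<^esub> ?W)) \<otimes>\<^bsub>M\<^esub> ?W'" by (simp only: FE')
  also have "\<dots> = ?E \<otimes>\<^bsub>M\<^esub> F \<otimes>\<^bsub>M\<^esub> (?W \<otimes>\<^bsub>M\<^esub> ?W')"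
    using c F(1) by (simp only: M.m_assoc M.m_closed)
  also have "\<dots> = F" using FE M.idem_comm[OF F(2) Ei] WW F c by simp
  finally have EF: "?E = F" .
  have "?W \<otimes>\<^bsub>M\<^esub> F = ?W \<otimes>\<^bsub>M\<^esub> F \<otimes>\<^bsub>M\<^esub> (?W' \<otimes>\<^bsub>M\<^esub> ?W)" using WW c F by simp
  also have "\<dots> = ?E \<otimes>\<^bsub>M\<^esub> ?W" using c F(1) by (simp only: M.m_assoc M.m_closed)
  finally show ?thesis using EF by (simp add: \<theta>_g[OF wx])
qed

lemma F_commutes: "h \<in> H \<Longrightarrow> \<theta> h \<otimes>\<^bsub>M\<^esub> F = F \<otimes>\<^bsub>M\<^esub> \<theta> h"
proof (induction h rule: generate.induct)
  case one
  then show ?case by (simp add: \<theta>_one T_closed)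
next
  case (incl h)
  then show ?case using F_commutes_ws by auto
next
  case (inv h)
  then have h: "h \<in> carrier G" and comm: "\<theta> h \<otimes>\<^bsub>M\<^esub> F = F \<otimes>\<^bsub>M\<^esub> \<theta> h"
    using F_commutes_ws ws by (auto intro!: gcl_closed)
  let ?W = "\<theta> h" and ?W' = "\<theta> (inv\<^bsub>G\<^esub> h)"
  have c: "?W \<in> carrier M" "?W' \<in> carrier M" "F \<in> carrier M" using h by (auto simp: \<theta>_closed T_closed)
  have "?W' \<otimes>\<^bsub>M\<^esub> F = ?W' \<otimes>\<^bsub>M\<^esub> F \<otimes>\<^bsub>M\<^esub> (?W \<otimes>\<^bsub>M\<^esub> ?W')" using \<theta>_inv[OF h] c by simp
  also have "\<dots> = ?W' \<otimes>\<^bsub>M\<^esub> (F \<otimes>\<^bsub>M\<^esub> ?W) \<otimes>\<^bsub>M\<^esub> ?W'" using c by (simp only: M.m_assoc M.m_closed)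
  also have "\<dots> = (?W' \<otimes>\<^bsub>M\<^esub> ?W) \<otimes>\<^bsub>M\<^esub> F \<otimes>\<^bsub>M\<^esub> ?W'" using c by (simp only: comm[symmetric] M.m_assoc M.m_closed)
  finally show ?case using \<theta>_inv[OF h] c by simp
next
  case (eng h h')
  then have h: "h \<in> carrier G" "h' \<in> carrier G" using H_carrier by auto
  then have c: "\<theta> h \<in> carrier M" "\<theta> h' \<in> carrier M" "F \<in> carrier M" by (auto simp: \<theta>_closed T_closed)
  have "\<theta> h \<otimes>\<^bsub>M\<^esub> \<theta> h' \<otimes>\<^bsub>M\<^esub> F = \<theta> h \<otimes>\<^bsub>M\<^esub> F \<otimes>\<^bsub>M\<^esub> \<theta> h'"
    using c eng.IH(2) by (simp only: M.m_assoc)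
  also have "\<dots> = F \<otimes>\<^bsub>M\<^esub> (\<theta> h \<otimes>\<^bsub>M\<^esub> \<theta> h')" using c eng.IH(1) by (simp only: M.m_assoc)
  finally show ?case using h by (simp only: \<theta>_mult)
qed

text \<open>The section \<open>h \<mapsto> t h t\<inverse>\<close> is multiplicative on \<open>H\<close> because \<open>H\<close> commutes with \<open>t\<inverse> t\<close>, while
  \<open>t t\<inverse> = 1\<close>.\<close>

definition \<sigma> where "\<sigma> h = T True \<otimes>\<^bsub>M\<^esub> \<theta> h \<otimes>\<^bsub>M\<^esub> T False"

lemma \<sigma>_mult:
  assumes "h \<in> H" "h' \<in> H" shows "\<sigma> (h \<otimes>\<^bsub>G\<^esub> h') = \<sigma> h \<otimes>\<^bsub>M\<^esub> \<sigma> h'"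
proof -
  have h: "h \<in> carrier G" "h' \<in> carrier G" using assms H_carrier by auto
  then have c: "\<theta> h \<in> carrier M" "\<theta> h' \<in> carrier M" "F \<in> carrier M" by (auto simp: \<theta>_closed T_closed)
  have "\<sigma> h \<otimes>\<^bsub>M\<^esub> \<sigma> h' = T True \<otimes>\<^bsub>M\<^esub> (\<theta> h \<otimes>\<^bsub>M\<^esub> F) \<otimes>\<^bsub>M\<^esub> (\<theta> h' \<otimes>\<^bsub>M\<^esub> T False)"
    using c by (simp only: \<sigma>_def M.m_assoc M.m_closed T_closed)
  also have "\<dots> = (T True \<otimes>\<^bsub>M\<^esub> T False) \<otimes>\<^bsub>M\<^esub> (T True \<otimes>\<^bsub>M\<^esub> (\<theta> h \<otimes>\<^bsub>M\<^esub> \<theta> h') \<otimes>\<^bsub>M\<^esub> T False)"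
    using c F_commutes[OF assms(1)] by (simp only: M.m_assoc M.m_closed T_closed)
  finally show ?thesis using c h by (simp add: T_right_inverse \<sigma>_def \<theta>_mult T_closed)
qed

lemma \<sigma>_one: "\<sigma> \<one>\<^bsub>G\<^esub> = \<one>\<^bsub>M\<^esub>"
  by (simp add: \<sigma>_def \<theta>_one T_closed T_right_inverse)

lemma \<sigma>_hom: "\<sigma> \<in> hom (G\<lparr>carrier := H\<rparr>) (units_of M)"
proof (rule homI)
  fix h assume "h \<in> carrier (G\<lparr>carrier := H\<rparr>)"
  then have h: "h \<in> H" "inv\<^bsub>G\<^esub> h \<in> H" "h \<in> carrier G"
    using H_subgroup H_carrier by (auto simp: subgroup.m_inv_closed)
  have "\<sigma> k \<in> carrier M" if "k \<in> carrier G" for k using that by (simp add: \<sigma>_def \<theta>_closed T_closed)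
  moreover have "\<sigma> h \<otimes>\<^bsub>M\<^esub> \<sigma> (inv\<^bsub>G\<^esub> h) = \<one>\<^bsub>M\<^esub>" "\<sigma> (inv\<^bsub>G\<^esub> h) \<otimes>\<^bsub>M\<^esub> \<sigma> h = \<one>\<^bsub>M\<^esub>"
    using h \<sigma>_mult[of h "inv\<^bsub>G\<^esub> h"] \<sigma>_mult[of "inv\<^bsub>G\<^esub> h" h] \<sigma>_one by simp_all
  ultimately show "\<sigma> h \<in> carrier (units_of M)"
    using h(3) by (auto simp: units_of_def Units_def intro!: bexI[of _ "\<sigma> (inv\<^bsub>G\<^esub> h)"])
qed (simp add: \<sigma>_mult units_of_def)

subsection \<open>\<open>H\<close> is a retract of the units of \<open>M\<close>\<close>

text \<open>The action on triples is right multiplication by the images of the letters in the extension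
  of \<open>G \<times> G\<close> by an infinite cyclic group whose generator \<open>t\<close> swaps the two factors, with \<open>G\<close>
  embedded in the first factor. It keeps \<open>t H t\<inverse>\<close> apart from \<open>G\<close>. Since the exponent sum of \<open>t\<close>
  cannot become negative in \<open>right_set\<close>, the units of \<open>M\<close> have exponent sum zero and their second
  coordinate lies in \<open>H\<close>.\<close>

definition tw_act where
  "tw_act = (\<lambda>(a, b) (x, y, m :: int).
     if a = t then (x, y, if b then m + 1 else m - 1)
     else if even m then (x \<otimes>\<^bsub>G\<^esub> g [(a, b)], y, m) else (x, y \<otimes>\<^bsub>G\<^esub> g [(a, b)], m))"

definition triples where "triples = carrier G \<times> carrier G \<times> (UNIV :: int set)"

definition right_set where
  "right_set = {(x, y, m) \<in> triples. m > 0 \<or> m = 0 \<and> y \<in> H}"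

sublocale tw: letter_action B tw_act triples
proof
  fix a b n assume a: "a \<in> B" and n: "n \<in> triples"
  show "tw_act (a, b) n \<in> triples"
    using a n by (auto simp: tw_act_def triples_def B_def gcl_closed)
  show "tw_act (a, \<not> b) (tw_act (a, b) n) = n"
  proof (cases "a = t")
    case True
    then show ?thesis by (cases n) (auto simp: tw_act_def)
  next
    case False
    then have ax: "a \<in> set xs" using a by (simp add: B_def)
    have "g [(a, \<not> b)] = inv\<^bsub>G\<^esub> g [(a, b)]"
      using inv_gcl[of "{r}" "set xs" "[(a, b)]"] ax r by simp
    then show ?thesis using False ax n by (auto simp: tw_act_def triples_def gcl_closed G.m_assoc)
  qed
qed

lemma right_set_triples: "right_set \<subseteq> triples"
  by (auto simp: right_set_def)

lemma tw_walk_word: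
  "u \<in> words (set xs) \<Longrightarrow> (x, y, m) \<in> right_set \<Longrightarrow> walk tw_act right_set u (x, y, m) =
    Some (if even m then (x \<otimes>\<^bsub>G\<^esub> g u, y, m) else (x, y \<otimes>\<^bsub>G\<^esub> g u, m))"
proof (induction u arbitrary: x y)
  case Nil
  then show ?case by (auto simp: right_set_def triples_def simp flip: one_group_pres)
next
  case (Cons c u)
  obtain a b where c: "c = (a, b)" "a \<in> set xs" "a \<noteq> t" using Cons.prems t by (cases c) auto
  have xy: "x \<in> carrier G" "y \<in> carrier G" using Cons.prems by (auto simp: right_set_def triples_def)
  have u: "u \<in> words (set xs)" using Cons.prems by simp
  have "tw_act c (x, y, m) \<in> right_set"
    using c Cons.prems(2) by (auto simp: tw_act_def right_set_def triples_def gcl_closed)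
  then show ?case
    using Cons.IH[OF u, of "x \<otimes>\<^bsub>G\<^esub> g [c]" y] Cons.IH[OF u, of x "y \<otimes>\<^bsub>G\<^esub> g [c]"] c Cons.prems xy
    by (auto simp: tw_act_def gcl_closed gcl_Cons[of _ "set xs" u] G.m_assoc)
qed

text \<open>Between the two letters \<open>t\<close> the walk is at a positive exponent. At exponent \<open>0\<close> it changes
  the second coordinate by an element of \<open>H\<close>, so it ends in \<open>right_set\<close> again.\<close>

lemma tw_walk_conj_t:
  assumes w: "w \<in> words (set xs)" "g w \<in> H" and n: "(x, y, m) \<in> right_set"
  shows "walk tw_act right_set (conj_t w) (x, y, m) =
    Some (if even m then (x, y \<otimes>\<^bsub>G\<^esub> g w, m) else (x \<otimes>\<^bsub>G\<^esub> g w, y, m))"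
proof -
  have xy: "x \<in> carrier G" "y \<in> carrier G" "m \<ge> 0" "m = 0 \<Longrightarrow> y \<in> H"
    using n by (auto simp: right_set_def triples_def)
  have n1: "(x, y, m + 1) \<in> right_set" using xy by (auto simp: right_set_def triples_def)
  have "y \<otimes>\<^bsub>G\<^esub> g w \<in> H" if "m = 0" using xy that w H_subgroup by (simp add: subgroup.m_closed)
  then show ?thesis
    using tw_walk_word[OF w(1) n1] n xy gcl_closed[OF w(1), of "{r}"]
    by (auto simp: conj_t_def walk_append tw_act_def right_set_def triples_def)
qed

lemma tw_relator: "n \<in> right_set \<Longrightarrow> walk tw_act right_set relator n = Some n"
  unfolding relator_def
proof (rule tw.walk_pad[OF right_set_triples])
  assume n: "n \<in> right_set"
  obtain x y m where nx: "n = (x, y, m)" by (cases n)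
  have xy: "x \<in> carrier G" "y \<in> carrier G" using n nx by (auto simp: right_set_def triples_def)
  show "walk tw_act right_set r n = Some n"
    using tw_walk_word[OF r] n nx g_r xy by simp
  show "set pieces \<subseteq> words B" by (rule pieces_words)
  fix p assume "p \<in> set pieces"
  then consider a where "a \<in> set xs" "p = [(a, True)]" | w where "w \<in> set ws" "p = conj_t w"
    by (auto simp: pieces_def)
  then show "walk tw_act right_set p n \<noteq> None \<and> walk tw_act right_set (winv p) n \<noteq> None"
  proof cases
    case 1
    then show ?thesis
      using tw_walk_word[of "[(a, True)]"] tw_walk_word[of "[(a, False)]"] n unfolding nx by simp
  next
    case 2
    then have w: "w \<in> words (set xs)" using ws by auto
    have "g (winv w) = inv\<^bsub>G\<^esub> (g w)" using inv_gcl[of "{r}" "set xs" w] r w by simp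
    then have "g (winv w) \<in> H" using 2 H_subgroup g_ws_H by (simp add: subgroup.m_inv_closed)
    then show ?thesis
      using tw_walk_conj_t[OF w] tw_walk_conj_t[of "winv w"] n w g_ws_H 2 unfolding nx
      by (simp add: winv_conj_t)
  qed
qed

lemma tw_act_word:
  "u \<in> words (set xs) \<Longrightarrow> (x, y, m) \<in> triples \<Longrightarrow> fold tw_act u (x, y, m) =
    (if even m then (x \<otimes>\<^bsub>G\<^esub> g u, y, m) else (x, y \<otimes>\<^bsub>G\<^esub> g u, m))"
proof (induction u arbitrary: x y)
  case Nil
  then show ?case by (auto simp: triples_def simp flip: one_group_pres)
next
  case (Cons c u)
  then show ?case using t
    by (cases c) (auto simp: tw_act_def triples_def gcl_closed gcl_Cons[of _ "set xs" u] G.m_assoc)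
qed

lemma tw_relator_triples: "n \<in> triples \<Longrightarrow> walk tw_act triples relator n = Some n"
  unfolding relator_def
proof (rule tw.walk_pad[OF order.refl])
  assume n: "n \<in> triples"
  have "fold tw_act r n = n" using n r g_r tw_act_word by (cases n) (auto simp: triples_def)
  then show "walk tw_act triples r n = Some n" using tw.walk_total[OF words_B[OF r] n] by simp
  show "set pieces \<subseteq> words B" by (rule pieces_words)
  fix p assume "p \<in> set pieces"
  then have "p \<in> words B" using pieces_words by blast
  then show "walk tw_act triples p n \<noteq> None \<and> walk tw_act triples (winv p) n \<noteq> None"
    using tw.walk_total n by simp
qed

abbreviation "origin \<equiv> (\<one>\<^bsub>G\<^esub>, \<one>\<^bsub>G\<^esub>, 0 :: int)"

lemma origin: "origin \<in> right_set" "origin \<in> triples"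
  using subgroup.one_closed[OF H_subgroup] by (auto simp: right_set_def triples_def)

lemma tw_act_well_defined:
  assumes "u \<in> words B" "v \<in> words B" "i u = i v"
  shows "fold tw_act u origin = fold tw_act v origin"
  using tw.icl_eq_imp_walk_eq[of triples "{relator}" u v origin] tw_relator_triples relator_words assms
    tw.walk_total[of u origin] tw.walk_total[of v origin] origin by simp

text \<open>The action is by right multiplications, so it commutes with left multiplication by
  \<open>(x, y, m)\<close>, which for even \<open>m\<close> does not swap the factors.\<close>

lemma tw_equivariant:
  assumes "v \<in> words B" "(x, y, m) \<in> triples" "fold tw_act v origin = (x', y', m')"
  shows "(even m \<longrightarrow> fold tw_act v (x, y, m) = (x \<otimes>\<^bsub>G\<^esub> x', y \<otimes>\<^bsub>G\<^esub> y', m + m')) \<and>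
    snd (snd (fold tw_act v (x, y, m))) = m + m'"
  using assms(1,3)
proof (induction v arbitrary: x' y' m' rule: rev_induct)
  case Nil
  then show ?case using assms(2) by (auto simp: triples_def)
next
  case (snoc c v)
  obtain a b where c: "c = (a, b)" "a \<in> B" using snoc.prems by (cases c) auto
  have v: "v \<in> words B" using snoc.prems by simp
  obtain x1 y1 m1 where o: "fold tw_act v origin = (x1, y1, m1)" by (cases "fold tw_act v origin")
  have o1: "x1 \<in> carrier G" "y1 \<in> carrier G" using tw.fold_closed[OF v origin(2)] o by (auto simp: triples_def)
  obtain x2 y2 m2 where n: "fold tw_act v (x, y, m) = (x2, y2, m2)" by (cases "fold tw_act v (x, y, m)")
  have xy: "x \<in> carrier G" "y \<in> carrier G" using assms(2) by (auto simp: triples_def)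
  have gc: "g [c] \<in> carrier G" if "a \<noteq> t" using that c by (simp add: gcl_closed B_def)
  show ?case
    using snoc.IH[OF v o] n snoc.prems(2) o o1 xy c gc
    by (auto simp: tw_act_def G.m_assoc split: if_splits)
qed

text \<open>A unit and its inverse both walk within \<open>right_set\<close> from the origin, so their exponents are
  nonnegative, and the exponents add up to \<open>0\<close>.\<close>

lemma unit_coordinates:
  assumes uv: "u \<in> words B" "v \<in> words B" "i u \<otimes>\<^bsub>M\<^esub> i v = \<one>\<^bsub>M\<^esub>" "i v \<otimes>\<^bsub>M\<^esub> i u = \<one>\<^bsub>M\<^esub>"
  obtains x y where "fold tw_act u origin = (x, y, 0)" "x \<in> carrier G" "y \<in> H"
proof -
  have in_N: "fold tw_act w origin \<in> right_set"
    if "w \<in> words B" "w' \<in> words B" "i w \<otimes>\<^bsub>M\<^esub> i w' = \<one>\<^bsub>M\<^esub>" for w w'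
    using tw.right_invertible_imp_walk[OF right_set_triples _ _ that origin(1)] relator_words tw_relator
      walk_in[of tw_act right_set w origin "fold tw_act w origin"] by simp
  obtain x y m where u: "fold tw_act u origin = (x, y, m)" by (cases "fold tw_act u origin")
  obtain x' y' m' where v: "fold tw_act v origin = (x', y', m')" by (cases "fold tw_act v origin")
  have un: "(x, y, m) \<in> right_set" and vn: "(x', y', m') \<in> right_set"
    using in_N[OF uv(1-3)] in_N[OF uv(2,1,4)] u v by auto
  have "fold tw_act (u @ v) origin = fold tw_act [] origin"
    by (rule tw_act_well_defined) (use uv in \<open>auto simp: icl_append one_special_inv\<close>)
  then have "fold tw_act v (x, y, m) = origin" using u by simp
  then have "m + m' = 0" using tw_equivariant[OF uv(2) _ v, of x y m] un right_set_triples by auto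
  moreover have "m \<ge> 0" "m' \<ge> 0" using un vn by (auto simp: right_set_def)
  ultimately have "m = 0" by simp
  then show ?thesis using that[of x y] u un by (auto simp: right_set_def triples_def)
qed

text \<open>The retraction reads off the second coordinate of the point to which a unit takes the
  origin.\<close>

definition \<rho> where "\<rho> x = fst (snd (fold tw_act (SOME u. u \<in> words B \<and> i u = x) origin))"

lemma \<rho>_i: "u \<in> words B \<Longrightarrow> \<rho> (i u) = fst (snd (fold tw_act u origin))"
  unfolding \<rho>_def
proof (rule someI2[of _ u])
  fix v assume "u \<in> words B" "v \<in> words B \<and> i v = i u"
  then show "fst (snd (fold tw_act v origin)) = fst (snd (fold tw_act u origin))"
    using tw_act_well_defined[of v u] by simp
qed simp

lemma \<rho>_hom: "\<rho> \<in> hom (units_of M) (G\<lparr>carrier := H\<rparr>)"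
proof -
  have rep: "\<exists>u\<in>words B. \<exists>x y. s = i u \<and> fold tw_act u origin = (x, y, 0) \<and> x \<in> carrier G \<and> y \<in> H"
    if s: "s \<in> Units M" for s
  proof -
    obtain u v where "u \<in> words B" "v \<in> words B" "s = i u" "i u \<otimes>\<^bsub>M\<^esub> i v = \<one>\<^bsub>M\<^esub>" "i v \<otimes>\<^bsub>M\<^esub> i u = \<one>\<^bsub>M\<^esub>"
      using s by (auto simp: Units_def carrier_special_inv)
    then show ?thesis by (metis unit_coordinates)
  qed
  show ?thesis
  proof (rule homI)
    fix s assume "s \<in> carrier (units_of M)"
    then have "s \<in> Units M" by (simp add: units_of_def)
    from rep[OF this] show "\<rho> s \<in> carrier (G\<lparr>carrier := H\<rparr>)" by (auto simp: \<rho>_i)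
  next
    fix s s' assume "s \<in> carrier (units_of M)" "s' \<in> carrier (units_of M)"
    then have ss: "s \<in> Units M" "s' \<in> Units M" by (simp_all add: units_of_def)
    obtain u x y where u: "u \<in> words B" "s = i u" "fold tw_act u origin = (x, y, 0)" "x \<in> carrier G" "y \<in> H"
      using rep[OF ss(1)] by blast
    obtain v x' y' where v: "v \<in> words B" "s' = i v" "fold tw_act v origin = (x', y', 0)"
      using rep[OF ss(2)] by blast
    have "(x, y, 0) \<in> triples" using u H_carrier by (auto simp: triples_def)
    from tw_equivariant[OF v(1) this v(3)]
    have "fold tw_act (u @ v) origin = (x \<otimes>\<^bsub>G\<^esub> x', y \<otimes>\<^bsub>G\<^esub> y', 0)" using u by simp
    then show "\<rho> (s \<otimes>\<^bsub>units_of M\<^esub> s') = \<rho> s \<otimes>\<^bsub>G\<lparr>carrier := H\<rparr>\<^esub> \<rho> s'"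
      using u v \<rho>_i[of u] \<rho>_i[of v] \<rho>_i[of "u @ v"] by (simp add: units_of_def icl_append)
  qed
qed

lemma \<rho>_\<sigma>: assumes "h \<in> H" shows "\<rho> (\<sigma> h) = h"
proof -
  obtain w where w: "w \<in> words (set xs)" "h = g w"
    using assms H_carrier by (auto simp: carrier_group_pres)
  have "\<sigma> h = i (conj_t w)"
    using w icl_append[of "[(t, True)]" B "w @ [(t, False)]"] icl_append[of w B "[(t, False)]"]
    by (simp add: \<sigma>_def conj_t_def t_B words_B icl_closed M.m_assoc \<theta>_g)
  moreover have "fold tw_act (conj_t w) origin = (\<one>\<^bsub>G\<^esub>, g w, 0)"
    using tw_walk_conj_t[OF w(1) _ origin(1)] walk_fold[of tw_act right_set "conj_t w" origin] assms w
      gcl_closed[OF w(1), of "{r}"] by simp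
  ultimately show ?thesis using \<rho>_i[of "conj_t w"] w by (simp add: conj_t_words words_B)
qed

lemma finitely_presented_H:
  assumes "finitely_presented (units_of M)"
  shows "finitely_presented (G\<lparr>carrier := H\<rparr>)"
  by (rule finitely_presented_retract[OF assms G.subgroup_imp_group[OF H_subgroup] \<sigma>_hom \<rho>_hom])
    (simp add: \<rho>_\<sigma>)

end

text \<open>The letters of the relator and of words for finitely many generators of the subgroup form a
  finite alphabet \<open>X\<close>, so there is a letter outside \<open>X\<close> even if \<open>A\<close> uses up the whole type.\<close>

lemma coherent_group_pres:
  fixes A :: "'a::infinite set"
  assumes units: "\<forall>(A :: 'a set) r. r \<in> words A \<longrightarrow>
      E_unitary (special_inv A {r}) \<longrightarrow> finitely_presented (units_of (special_inv A {r}))"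
    and r: "r \<in> words A"
  shows "coherent (group_pres A {r})"
  unfolding coherent_def
proof (intro allI impI)
  fix K assume K: "subgroup K (group_pres A {r})"
    and fg: "finitely_generated ((group_pres A {r})\<lparr>carrier := K\<rparr>)"
  interpret A: group "group_pres A {r}" by (rule group_group_pres) (use r in simp)
  obtain S where S: "S \<subseteq> K" "finite S" "generate (group_pres A {r}) S = K"
    using fg A.generate_consistent[OF _ K] by (auto simp: finitely_generated_def)
  have "S \<subseteq> gcl A {r} ` words A" using S K subgroup.subset by (fastforce simp: carrier_group_pres)
  then obtain W where W: "W \<subseteq> words A" "finite W" "S = gcl A {r} ` W"
    using finite_subset_image[OF S(2)] by blast
  obtain ws where ws: "set ws = insert [] W" using finite_list[of "insert [] W"] W(2) by auto
  have wsA: "set ws \<subseteq> words A" using ws W by simp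
  have gK: "generate (group_pres A {r}) (gcl A {r} ` set ws) = K"
  proof
    have "gcl A {r} ` set ws \<subseteq> K"
      using S W ws subgroup.one_closed[OF K] by (auto simp: one_group_pres)
    then show "generate (group_pres A {r}) (gcl A {r} ` set ws) \<subseteq> K"
      by (rule A.generate_subgroup_incl[OF _ K])
    have "generate (group_pres A {r}) S \<subseteq> generate (group_pres A {r}) (gcl A {r} ` set ws)"
      by (rule A.mono_generate) (use W ws in auto)
    then show "K \<subseteq> generate (group_pres A {r}) (gcl A {r} ` set ws)" using S by simp
  qed
  define X where "X = (\<Union>w\<in>insert r (set ws). fst ` set w)"
  have fin: "finite X" by (simp add: X_def)
  have XA: "X \<subseteq> A" and rX: "r \<in> words X" and wsX: "set ws \<subseteq> words X"
    using r wsA unfolding X_def words_iff subset_iff by blast+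
  obtain xs where xs: "set xs = X" using finite_list[OF fin] by auto
  obtain t where t: "t \<notin> X" using ex_new_if_finite[OF infinite_UNIV fin] by blast
  interpret unit_coding xs r ws t
    by unfold_locales (use rX wsX ws xs t in auto)
  have "finitely_presented (units_of M)" using units relator_words E_unitary_M by blast
  then have "finitely_presented (G\<lparr>carrier := H\<rparr>)" by (rule finitely_presented_H)
  moreover have "G\<lparr>carrier := H\<rparr> \<cong> (group_pres A {r})\<lparr>carrier := K\<rparr>"
    using generate_subalphabet_iso[OF XA _ wsX, of "{r}"] rX gK by (simp add: xs)
  ultimately show "finitely_presented ((group_pres A {r})\<lparr>carrier := K\<rparr>)"
    using finitely_presented_iso[OF A.subgroup_imp_group[OF K]]
      group.iso_sym[OF G.subgroup_imp_group[OF H_subgroup]] by blast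
qed

section \<open>Coherence and groups of units\<close>

theorem theorem7p8:
  shows "(\<forall>(A :: 'a::infinite set) r. r \<in> words A \<longrightarrow>
            finitely_presented (group_pres A {r}) \<longrightarrow> coherent (group_pres A {r}))
         \<longleftrightarrow>
         (\<forall>(A :: 'a set) r. r \<in> words A \<longrightarrow>
            E_unitary (special_inv A {r}) \<longrightarrow> finitely_presented (units_of (special_inv A {r})))"
proof (intro iffI allI impI)
  fix A :: "'a set" and r
  assume coh: "\<forall>(A :: 'a set) r. r \<in> words A \<longrightarrow>
      finitely_presented (group_pres A {r}) \<longrightarrow> coherent (group_pres A {r})"
    and "r \<in> words A" "E_unitary (special_inv A {r})"
  then interpret E_unitary_one_relator A r by unfold_locales
  show "finitely_presented (units_of M)" by (rule finitely_presented_units[OF coh])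
qed (rule coherent_group_pres)

end
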